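(* If $e_{(2)}\ne 0.5$ and $$\underline{\lambda}_i>\theta_i\,\frac{e_{(2)}}{1-2e_{(2)}},\qquad\forall i\in[N],$$ then $c$ is concave on $\Lambda$ and coincides with the optimal value function of the corresponding MDP, i.e. $c(\boldsymbol{\lambda})=c^{\mathrm{MDP}}(\boldsymbol{\lambda})$ for all $\boldsymbol{\lambda}\in\Lambda$.
   Context: Fix an integer $N\ge 1$ and write $[N]=\{1,\dots,N\}$. Costs $c_{(i)}>0$ and $c_{(i,j)}>0$ ($i,j\in[N]$) are given with $c_{(i)}=c_{(i,i)}\le c_{(i,j)}=c_{(j,i)}$ for all $i,j\in[N]$. The parameters satisfy $0<\theta_1\le\theta_2\le\dots\le\theta_N$, with $\theta_N/\theta_1>1$. The domain is the box $\Lambda=[\underline{\boldsymbol{\lambda}},\overline{\boldsymbol{\lambda}}]=\{\boldsymbol{\lambda}\in\mathbb{R}^N:\underline{\lambda}_i\le\lambda_i\le\overline{\lambda}_i\ \forall i\}$ with $\underline{\lambda}_i>0$ for all $i$. For $\boldsymbol{\lambda}\in\Lambda$, $c(\boldsymbol{\lambda})$ is the optimal value of the linear program in variables $\boldsymbol{x}=(x_{i,j})_{i,j\in[N]}$, $\boldsymbol{y}=(y_i)_{i\in[N]}$: minimize $\sum_{i,j\in[N]}c_{(i,j)}x_{i,j}+\sum_{i\in[N]}c_{(i)}y_i$ subject to $\sum_{j\in[N]}x_{j,i}+\sum_{j\in[N]}x_{i,j}+y_i=\lambda_i$ for all $i\in[N]$; $\theta_i x_{i,j}\le\lambda_j y_i$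 for all $i,j\in[N]$; $x_{i,j}\ge 0$ for all $i,j\in[N]$; $y_i\ge 0$ for all $i\in[N]$. Matching efficiency: $e_{i,j}=1-c_{(i,j)}/(c_{(i)}+c_{(j)})$ for $i,j\in[N]$ (so $e_{i,i}=0.5$ and $e_{i,j}\le 0.5$). For each $i$, let $e_{i,(1)}\ge e_{i,(2)}\ge\dots\ge e_{i,(N)}$ be the values $e_{i,1},\dots,e_{i,N}$ sorted in descending order. For a positive integer $k$, the $k$-th critical matching efficiency is $e_{(k)}=\max_{i\in[N]}e_{i,(k)}$ if $k\le N$, and $e_{(k)}=0$ if $k>N$. MDP: demands of type $i\in[N]$ arrive according to independent Poisson processes with rates $\lambda_i$; a type-$i$ demand has an independent exponential sojourn time with rate $\theta_i$. The state $\mathbf{s}=(s_1,\dots,s_N)\in\mathbb{Z}_{\ge 0}^N$ records the numbers of waiting demands of each type; the system starts empty. A stationary matching policy $\boldsymbol{\phi}=(\phi_i)_{i\in[N]}$, $\phi_i:\mathbb{Z}_{\ge 0}^N\to[N]\cup\{0\}$, decides, when a type-$i$ demand arrives in state $\mathbf{s}$, either to match it immediately with a waiting demand of type $j=\phi_i(\mathbf{s})$ with $s_j>0$ (both leave, and cost $c_{(i,j)}$ is incurred), or (if $\phi_i(\mathbf{s})=0$) to let it wait. If a waiting type-$i$ demand's sojourn time expires before it is matched, it leaves and a cost $c_{(i)}$ is incurred. Let $C^{\boldsymbol{\lambda},\boldsymbol{\phi}}(T)$ be the total cost incurred by time $T$. The optimal value function is the minimum expected long-run average cost $c^{\mathrm{MDP}}(\boldsymbol{\lambda})=\inf_{\boldsymbol{\phi}}\limsup_{T\to\infty}\frac{1}{T}\mathbb{E}[C^{\boldsymbol{\lambda},\boldsymbol{\phi}}(T)]$.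 *)

theory Defs
  imports "HOL-Probability.Probability"
begin

section \<open>The linear program\<close>

definition lp_feasible ::
  "('n::finite \<Rightarrow> real) \<Rightarrow> real ^ 'n \<Rightarrow> ('n \<Rightarrow> 'n \<Rightarrow> real) \<Rightarrow> ('n \<Rightarrow> real) \<Rightarrow> bool" where
  "lp_feasible \<theta> r x y \<longleftrightarrow>
     (\<forall>i. (\<Sum>j\<in>UNIV. x j i) + (\<Sum>j\<in>UNIV. x i j) + y i = r $ i) \<and>
     (\<forall>i j. \<theta> i * x i j \<le> r $ j * y i) \<and>
     (\<forall>i j. 0 \<le> x i j) \<and>
     (\<forall>i. 0 \<le> y i)"

definition lp_objective ::
  "('n::finite \<Rightarrow> real) \<Rightarrow> ('n \<Rightarrow> 'n \<Rightarrow> real) \<Rightarrow> ('n \<Rightarrow> 'n \<Rightarrow> real) \<Rightarrow> ('n \<Rightarrow> real) \<Rightarrow> real" where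
  "lp_objective c1 c2 x y = (\<Sum>i\<in>UNIV. \<Sum>j\<in>UNIV. c2 i j * x i j) + (\<Sum>i\<in>UNIV. c1 i * y i)"

text \<open>For positive rates and costs the feasible set is nonempty (take x = 0, y = r) and compact,
  so the infimum is the optimal value of the program.\<close>

definition lp_value ::
  "('n::finite \<Rightarrow> real) \<Rightarrow> ('n \<Rightarrow> 'n \<Rightarrow> real) \<Rightarrow> ('n \<Rightarrow> real) \<Rightarrow> real ^ 'n \<Rightarrow> real" where
  "lp_value c1 c2 \<theta> r = Inf {lp_objective c1 c2 x y | x y. lp_feasible \<theta> r x y}"

section \<open>Matching efficiencies\<close>

definition efficiency :: "('n \<Rightarrow> real) \<Rightarrow> ('n \<Rightarrow> 'n \<Rightarrow> real) \<Rightarrow> 'n \<Rightarrow> 'n \<Rightarrow> real" where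
  "efficiency c1 c2 i j = 1 - c2 i j / (c1 i + c1 j)"

text \<open>The k-th largest (k = 1, ..., CARD('n)) of the efficiencies of type i, with repetitions.\<close>

definition sorted_efficiency ::
  "('n::finite \<Rightarrow> real) \<Rightarrow> ('n \<Rightarrow> 'n \<Rightarrow> real) \<Rightarrow> 'n \<Rightarrow> nat \<Rightarrow> real" where
  "sorted_efficiency c1 c2 i k =
     rev (sorted_list_of_multiset (image_mset (efficiency c1 c2 i) (mset_set UNIV))) ! (k - 1)"

definition critical_efficiency ::
  "('n::finite \<Rightarrow> real) \<Rightarrow> ('n \<Rightarrow> 'n \<Rightarrow> real) \<Rightarrow> nat \<Rightarrow> real" where
  "critical_efficiency c1 c2 k =
     (if k \<le> CARD('n) then Max (range (\<lambda>i. sorted_efficiency c1 c2 i k)) else 0)"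

section \<open>The dynamic matching process\<close>

text \<open>The primitive random variables. Demands of each type are numbered 0, 1, 2, ... in order of
  arrival. \<open>Gap i k\<close> is the time between the arrivals of demands k - 1 and k of type i (for k = 0,
  the time until the first arrival); \<open>Sojourn i k\<close> is the sojourn time of demand k of type i.
  Independent exponential gaps make the arrivals of each type a Poisson process.\<close>

datatype 'n clock = Gap 'n nat | Sojourn 'n nat

primrec clock_rate :: "('n::finite \<Rightarrow> real) \<Rightarrow> real ^ 'n \<Rightarrow> 'n clock \<Rightarrow> real" where
  "clock_rate \<theta> r (Gap i k) = r $ i"
| "clock_rate \<theta> r (Sojourn i k) = \<theta> i"

definition clock_space :: "('n::finite \<Rightarrow> real) \<Rightarrow> real ^ 'n \<Rightarrow> ('n clock \<Rightarrow> real) measure" where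
  "clock_space \<theta> r =
     Pi\<^sub>M UNIV (\<lambda>q. density lborel (\<lambda>t. ennreal (exponential_density (clock_rate \<theta> r q) t)))"

datatype 'n event = Arrival 'n nat | Expiry 'n nat

primrec event_time :: "('n clock \<Rightarrow> real) \<Rightarrow> 'n event \<Rightarrow> real" where
  "event_time \<omega> (Arrival i k) = (\<Sum>l\<le>k. \<omega> (Gap i l))"
| "event_time \<omega> (Expiry i k) = (\<Sum>l\<le>k. \<omega> (Gap i l)) + \<omega> (Sojourn i k)"

text \<open>A configuration consists of the number of arrivals so far of each type and the set of the
  waiting demands, each given by its type and its number.\<close>

type_synonym 'n config = "('n \<Rightarrow> nat) \<times> ('n \<times> nat) set"

definition queue_state :: "('n \<times> nat) set \<Rightarrow> 'n \<Rightarrow> nat" where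
  "queue_state W i = card {k. (i, k) \<in> W}"

text \<open>A stationary policy maps the type of an arriving demand and the state found on arrival to
  the type of the waiting demand to be matched with; \<open>None\<close> lets the arriving demand wait.\<close>

type_synonym 'n policy = "'n \<Rightarrow> ('n \<Rightarrow> nat) \<Rightarrow> 'n option"

definition admissible :: "'n policy \<Rightarrow> bool" where
  "admissible \<phi> \<longleftrightarrow> (\<forall>i s j. \<phi> i s = Some j \<longrightarrow> 0 < s j)"

text \<open>Among the waiting demands of the chosen type, the one that arrived first is matched.\<close>

fun step :: "'n policy \<Rightarrow> 'n config \<Rightarrow> 'n event \<Rightarrow> 'n config" where
  "step \<phi> (a, W) (Arrival i k) =
     (a(i := Suc k),
      case \<phi> i (queue_state W) of
        None \<Rightarrow> insert (i, k) W
      | Some j \<Rightarrow> W - {(j, LEAST l. (j, l) \<in> W)})"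
| "step \<phi> (a, W) (Expiry i k) = (a, W - {(i, k)})"

fun event_cost ::
  "('n \<Rightarrow> real) \<Rightarrow> ('n \<Rightarrow> 'n \<Rightarrow> real) \<Rightarrow> 'n policy \<Rightarrow> 'n config \<Rightarrow> 'n event \<Rightarrow> real" where
  "event_cost c1 c2 \<phi> (a, W) (Arrival i k) =
     (case \<phi> i (queue_state W) of None \<Rightarrow> 0 | Some j \<Rightarrow> c2 i j)"
| "event_cost c1 c2 \<phi> (a, W) (Expiry i k) = c1 i"

definition pending :: "'n config \<Rightarrow> 'n event set" where
  "pending \<sigma> = range (\<lambda>i. Arrival i (fst \<sigma> i)) \<union> (\<lambda>(i, k). Expiry i k) ` snd \<sigma>"

text \<open>The pending events are finitely many; ties between them have probability zero.\<close>

definition next_event :: "('n clock \<Rightarrow> real) \<Rightarrow> 'n config \<Rightarrow> 'n event" where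
  "next_event \<omega> \<sigma> = arg_min_on (event_time \<omega>) (pending \<sigma>)"

primrec config_after :: "'n policy \<Rightarrow> ('n clock \<Rightarrow> real) \<Rightarrow> nat \<Rightarrow> 'n config" where
  "config_after \<phi> \<omega> 0 = ((\<lambda>_. 0), {})"
| "config_after \<phi> \<omega> (Suc m) =
     step \<phi> (config_after \<phi> \<omega> m) (next_event \<omega> (config_after \<phi> \<omega> m))"

definition total_cost ::
  "('n \<Rightarrow> real) \<Rightarrow> ('n \<Rightarrow> 'n \<Rightarrow> real) \<Rightarrow> 'n policy \<Rightarrow> real \<Rightarrow> ('n clock \<Rightarrow> real) \<Rightarrow> ennreal" where
  "total_cost c1 c2 \<phi> T \<omega> =
     (\<Sum>m. let \<sigma> = config_after \<phi> \<omega> m; e = next_event \<omega> \<sigma>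
           in if event_time \<omega> e \<le> T then ennreal (event_cost c1 c2 \<phi> \<sigma> e) else 0)"

definition average_cost ::
  "('n::finite \<Rightarrow> real) \<Rightarrow> ('n \<Rightarrow> 'n \<Rightarrow> real) \<Rightarrow> ('n \<Rightarrow> real) \<Rightarrow> real ^ 'n \<Rightarrow> 'n policy \<Rightarrow> ennreal" where
  "average_cost c1 c2 \<theta> r \<phi> =
     Limsup at_top (\<lambda>T::real.
       (\<integral>\<^sup>+\<omega>. total_cost c1 c2 \<phi> T \<omega> \<partial>clock_space \<theta> r) / ennreal T)"

definition mdp_value ::
  "('n::finite \<Rightarrow> real) \<Rightarrow> ('n \<Rightarrow> 'n \<Rightarrow> real) \<Rightarrow> ('n \<Rightarrow> real) \<Rightarrow> real ^ 'n \<Rightarrow> ennreal" where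
  "mdp_value c1 c2 \<theta> r = (INF \<phi>\<in>{\<phi>. admissible \<phi>}. average_cost c1 c2 \<theta> r \<phi>)"

end

(* In residual time, the system after each event is again a run driven by independent exponential
   clocks: a fresh copy of the clocks that have not been read yet. This one-step recursion turns drift
   inequalities for a potential of the queue lengths into bounds on the expected cost by time T.

   Under the rate condition, matching demands of equal type only is optimal in the linear program.
   Its dual prices u_i = c_i (l_i + th_i) / (2 l_i + th_i) satisfy u_i + u_j <= c_ij for i <> j, and
   sum_i u_i l_i is concave in l. With the linear potential sum_i u_i s_i the drift of the greedy
   same-type policy is exactly this value; for every other policy it is at least this value, since
   a matching within type i requires s_i >= 1. *)

theory Submission
  imports Defs
begin

section \<open>Independent exponential clocks\<close>

text \<open>A pending event's clock is partly used up, so the clocks are no longer an independent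
  family once the run is observed; memorylessness restores the product law. Comparing a run with
  \<open>h + \<rho> * T\<close> over its first event leaves the term
  \<open>exp (- T * L) * h\<close> for no event in time, \<open>L\<close> being the total rate. Its
  sign decides which inequality survives: upper bounds need a nonnegative potential, lower bounds a
  nonpositive one. The linear potential serves for the upper bound, but a policy may let queues grow
  without limit, so no constant shifts it below zero. Subtracting a small multiple of the squared
  queue lengths bounds it from above, and expiries, whose rate grows with the queue, keep the
  resulting error in the drift bounded. The induction on the number of events also needs a terminal
  reward in lower bounds, whose weight vanishes because events cannot accumulate.\<close>

definition elapse :: "'q set \<Rightarrow> real \<Rightarrow> ('q \<Rightarrow> real) \<Rightarrow> 'q \<Rightarrow> real" where
  "elapse P t \<xi> = (\<lambda>q. if q \<in> P then \<xi> q - t else \<xi> q)"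

text \<open>\<open>arg_min_on\<close> breaks ties by \<open>SOME\<close> and has no explicit form.
  It factors through the set of minimisers, which takes finitely many values, and every map out of a
  discrete space is measurable.\<close>

lemma measurable_arg_min_on:
  fixes f :: "'b \<Rightarrow> 'a \<Rightarrow> real"
  assumes "finite P" and f: "\<And>e. e \<in> P \<Longrightarrow> f e \<in> borel_measurable M"
  shows "(\<lambda>\<xi>. arg_min_on (\<lambda>e. f e \<xi>) P) \<in> measurable M (count_space UNIV)"
proof -
  define A where "A \<xi> = {e \<in> P. \<forall>e'\<in>P. f e \<xi> \<le> f e' \<xi>}" for \<xi>
  have "A \<in> measurable M (count_space (Pow P))"
  proof (subst measurable_count_space_eq2)
    show "finite (Pow P)" using \<open>finite P\<close> by simp
    show "A \<in> space M \<rightarrow> Pow P \<and> (\<forall>a\<in>Pow P. A -` {a} \<inter> space M \<in> sets M)"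
    proof safe
      fix a assume "a \<subseteq> P"
      then have "A \<xi> = a \<longleftrightarrow> (\<forall>e\<in>P. (e \<in> a) = (\<forall>e'\<in>P. f e \<xi> \<le> f e' \<xi>))" for \<xi>
        unfolding A_def by blast
      moreover have "Measurable.pred M (\<lambda>\<xi>. \<forall>e\<in>P. (e \<in> a) = (\<forall>e'\<in>P. f e \<xi> \<le> f e' \<xi>))"
        unfolding not_less[symmetric]
        by (intro pred_intros_finite pred_intros_logic borel_measurable_pred_less f \<open>finite P\<close>) simp_all
      ultimately have "Measurable.pred M (\<lambda>\<xi>. A \<xi> = a)"
        by simp
      then show "A -` {a} \<inter> space M \<in> sets M"
        by (simp add: Measurable.pred_def vimage_def Int_def conj_commute)
    qed (auto simp: A_def)
  qed
  then have "(\<lambda>\<xi>. SOME e. e \<in> A \<xi>) \<in> measurable M (count_space UNIV)"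
    by (rule measurable_compose) simp
  moreover have "arg_min_on (\<lambda>e. f e \<xi>) P = (SOME e. e \<in> A \<xi>)" for \<xi>
    by (simp add: arg_min_on_def arg_min_def is_arg_min_linorder A_def Ball_def)
  ultimately show ?thesis by simp
qed

lemma measurable_elapse [measurable (raw)]:
  assumes "f \<in> borel_measurable N" and "g \<in> measurable N (Pi\<^sub>M UNIV (\<lambda>_. borel))"
  shows "(\<lambda>x. elapse P (f x) (g x)) \<in> measurable N (Pi\<^sub>M UNIV (\<lambda>_. borel))"
proof -
  have "(\<lambda>x. g x q) \<in> borel_measurable N" for q
    using measurable_compose[OF assms(2) measurable_component_singleton[of q]] by simp
  with assms(1) show ?thesis
    unfolding elapse_def by (intro measurable_PiM_single') (auto simp: space_PiM)
qed

lemma measurable_fun_upd_PiM [measurable (raw)]: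
  assumes "f \<in> borel_measurable N" and "g \<in> measurable N (Pi\<^sub>M UNIV (\<lambda>_. borel))"
  shows "(\<lambda>x. (g x)(q := f x :: real)) \<in> measurable N (Pi\<^sub>M UNIV (\<lambda>_. borel))"
proof -
  have "(\<lambda>x. g x q) \<in> borel_measurable N" for q
    using measurable_compose[OF assms(2) measurable_component_singleton[of q]] by simp
  with assms(1) show ?thesis
    unfolding fun_upd_def by (intro measurable_PiM_single') (auto simp: space_PiM)
qed

lemma measurable_apply_PiM:
  assumes "g \<in> measurable N (Pi\<^sub>M UNIV (\<lambda>_. borel :: real measure))"
  shows "(\<lambda>x. g x q) \<in> borel_measurable N"
  using measurable_compose[OF assms measurable_component_singleton[of q]] by simp

lemma pred_all_gt:
  fixes f :: "'a \<Rightarrow> real"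
  assumes "finite P" and "f \<in> borel_measurable N" "g \<in> measurable N (Pi\<^sub>M UNIV (\<lambda>_. borel))"
  shows "Measurable.pred N (\<lambda>x. \<forall>p\<in>P. f x < g x p)"
proof (intro pred_intros_finite assms(1))
  fix p
  have [measurable]: "(\<lambda>x. g x p) \<in> borel_measurable N"
    using assms(3) by (rule measurable_apply_PiM)
  show "Measurable.pred N (\<lambda>x. f x < g x p)"
    using assms(2) by measurable
qed

section \<open>Memorylessness and the law of the first clock to ring\<close>

locale exponential_clocks =
  fixes rate :: "'q \<Rightarrow> real"
  assumes rate_pos: "0 < rate q"
begin

abbreviation law :: "'q \<Rightarrow> real measure" where
  "law q \<equiv> density lborel (\<lambda>t. ennreal (exponential_density (rate q) t))"

abbreviation clocks :: "('q \<Rightarrow> real) measure" where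
  "clocks \<equiv> Pi\<^sub>M UNIV law"

lemma sets_clocks [measurable_cong]: "sets clocks = sets (Pi\<^sub>M UNIV (\<lambda>_. borel))"
  by (rule sets_PiM_cong) simp_all

lemma space_clocks [simp]: "space clocks = UNIV"
  by (simp add: space_PiM)

lemma prob_space_law: "prob_space (law q)"
  by (rule prob_space_exponential_density[OF rate_pos])

lemma prob_space_clocks: "prob_space clocks"
  by (intro prob_space_PiM prob_space_law)

sublocale clocks: prob_space clocks by (rule prob_space_clocks)

lemma nn_integral_law:
  assumes [measurable]: "f \<in> borel_measurable borel"
  shows "(\<integral>\<^sup>+t. f t \<partial>law q) =
    (\<integral>\<^sup>+t. ennreal (rate q * exp (- t * rate q)) * indicator {0..} t * f t \<partial>lborel)"
  by (subst nn_integral_density)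
     (auto intro!: nn_integral_cong simp: exponential_density_def erlang_density_def indicator_def mult.commute)

text \<open>Overwriting one coordinate by an independent draw preserves the product law. The inner
  integral again runs over all clocks, so coordinates can be split off one after another without
  changing the index set.\<close>

lemma nn_integral_resample:
  assumes [measurable]: "f \<in> borel_measurable (Pi\<^sub>M UNIV (\<lambda>_. borel))"
  shows "(\<integral>\<^sup>+\<xi>. f \<xi> \<partial>clocks) = (\<integral>\<^sup>+t. \<integral>\<^sup>+\<xi>. f (\<xi>(q := t)) \<partial>clocks \<partial>law q)"
proof -
  have "(\<integral>\<^sup>+\<xi>. f \<xi> \<partial>clocks) =
      (\<integral>\<^sup>+\<xi>. f \<xi> \<partial>distr (law q \<Otimes>\<^sub>M clocks) clocks (\<lambda>(x, X). X(q := x)))"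
    using distr_pair_PiM_eq_PiM[of UNIV law q] prob_space_law by simp
  also have "\<dots> = (\<integral>\<^sup>+z. f (case z of (x, X) \<Rightarrow> X(q := x)) \<partial>(law q \<Otimes>\<^sub>M clocks))"
    by (rule nn_integral_distr) measurable
  also have "\<dots> = (\<integral>\<^sup>+t. \<integral>\<^sup>+\<xi>. f (\<xi>(q := t)) \<partial>clocks \<partial>law q)"
    by (subst clocks.nn_integral_fst[symmetric]) (auto simp: split_beta')
  finally show ?thesis .
qed

text \<open>With the other coordinates fixed, a tie is a single value of \<open>\<xi> p\<close>,
  hence null for a law with a density.\<close>

lemma AE_clocks_neq:
  assumes "p \<noteq> q"
  shows "AE \<xi> in clocks. \<xi> p \<noteq> \<xi> q"
proof -
  let ?C = "Pi\<^sub>M UNIV (\<lambda>_. borel) :: ('q \<Rightarrow> real) measure"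
  have "Measurable.pred ?C (\<lambda>\<xi>. \<not> (\<xi> p < \<xi> q) \<and> \<not> (\<xi> q < \<xi> p))"
    by (intro pred_intros_logic borel_measurable_pred_less) (simp_all add: measurable_apply_PiM)
  moreover have "(\<lambda>\<xi> :: 'q \<Rightarrow> real. \<not> (\<xi> p < \<xi> q) \<and> \<not> (\<xi> q < \<xi> p)) = (\<lambda>\<xi>. \<xi> p = \<xi> q)"
    by auto
  ultimately have [measurable]: "Measurable.pred ?C (\<lambda>\<xi>. \<xi> p = \<xi> q)"
    by simp
  then have ev: "{\<xi>. \<xi> p = \<xi> q} \<in> sets clocks"
    by (simp add: Measurable.pred_def sets_clocks space_PiM)
  have "emeasure clocks {\<xi>. \<xi> p = \<xi> q} = (\<integral>\<^sup>+\<xi>. indicator {\<xi>. \<xi> p = \<xi> q} \<xi> \<partial>clocks)"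
    by (rule nn_integral_indicator[symmetric]) fact
  also have "\<dots> = (\<integral>\<^sup>+t. \<integral>\<^sup>+\<xi>. indicator {\<xi>. \<xi> p = \<xi> q} (\<xi>(p := t)) \<partial>clocks \<partial>law p)"
    by (rule nn_integral_resample) measurable
  also have "\<dots> = (\<integral>\<^sup>+\<xi>. \<integral>\<^sup>+t. indicator {\<xi>. \<xi> p = \<xi> q} (\<xi>(p := t)) \<partial>law p \<partial>clocks)"
  proof -
    interpret law: prob_space "law p" by (rule prob_space_law)
    interpret pair_prob_space clocks "law p" ..
    show ?thesis by (rule Fubini') measurable
  qed
  also have "\<dots> = (\<integral>\<^sup>+\<xi>. 0 \<partial>clocks)"
  proof (rule nn_integral_cong)
    fix \<xi> :: "'q \<Rightarrow> real"
    have "AE t in lborel. t \<noteq> \<xi> q" by (rule AE_lborel_singleton)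
    then have "AE t in law p. t \<noteq> \<xi> q"
      by (subst AE_density) auto
    then show "(\<integral>\<^sup>+t. indicator {\<xi>. \<xi> p = \<xi> q} (\<xi>(p := t)) \<partial>law p) = 0"
      using assms by (subst nn_integral_0_iff_AE) (auto elim!: eventually_mono)
  qed
  finally show ?thesis
    using ev by (intro AE_I[of _ _ "{\<xi>. \<xi> p = \<xi> q}"]) auto
qed

text \<open>Induction on \<open>P\<close> with \<open>f\<close> arbitrary: the clock
  \<open>p\<close> is split off by resampling, and the hypothesis is applied to \<open>f\<close>
  with that coordinate frozen. Shifting the exponential integral by \<open>t\<close> contributes the
  factor \<open>exp (- t * rate p)\<close>.\<close>

lemma memoryless:
  assumes "finite P" and "0 \<le> t" and "f \<in> borel_measurable (Pi\<^sub>M UNIV (\<lambda>_. borel))"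
  shows "(\<integral>\<^sup>+\<xi>. indicator {\<xi>. \<forall>p\<in>P. t < \<xi> p} \<xi> * f (elapse P t \<xi>) \<partial>clocks) =
    ennreal (exp (- t * sum rate P)) * (\<integral>\<^sup>+\<xi>. f \<xi> \<partial>clocks)"
  using assms(1,3)
proof (induction P arbitrary: f rule: finite_induct)
  case empty
  then show ?case by (simp add: elapse_def)
next
  case (insert p P)
  note [measurable] = \<open>f \<in> borel_measurable (Pi\<^sub>M UNIV (\<lambda>_. borel))\<close>
  let ?g = "\<lambda>x. \<integral>\<^sup>+\<xi>. f (\<xi>(p := x)) \<partial>clocks"
  have [measurable]: "Measurable.pred (Pi\<^sub>M UNIV (\<lambda>_. borel)) (\<lambda>\<xi>. \<forall>q\<in>insert p P. t < \<xi> q)"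
      "Measurable.pred (Pi\<^sub>M UNIV (\<lambda>_. borel)) (\<lambda>\<xi>. \<forall>q\<in>P. t < \<xi> q)"
    using insert.hyps by (intro pred_all_gt measurable_const measurable_ident_sets refl; simp)+
  have meas: "(\<lambda>\<xi>. indicator {\<xi>. \<forall>q\<in>insert p P. t < \<xi> q} \<xi> * f (elapse (insert p P) t \<xi>))
      \<in> borel_measurable (Pi\<^sub>M UNIV (\<lambda>_. borel))"
    by measurable
  have upd: "elapse (insert p P) t (\<xi>(p := x)) = (elapse P t \<xi>)(p := x - t)" for \<xi> x
    using insert.hyps by (auto simp: elapse_def)
  have ind: "indicator {\<xi>. \<forall>q\<in>insert p P. t < \<xi> q} (\<xi>(p := x)) =
      indicator {t<..} x * (indicator {\<xi>. \<forall>q\<in>P. t < \<xi> q} \<xi> :: ennreal)" for \<xi> x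
    using insert.hyps by (auto simp: indicator_def)
  have "(\<integral>\<^sup>+\<xi>. indicator {\<xi>. \<forall>q\<in>insert p P. t < \<xi> q} \<xi> * f (elapse (insert p P) t \<xi>) \<partial>clocks) =
      (\<integral>\<^sup>+x. \<integral>\<^sup>+\<xi>. indicator {t<..} x * (indicator {\<xi>. \<forall>q\<in>P. t < \<xi> q} \<xi> *
         f ((elapse P t \<xi>)(p := x - t))) \<partial>clocks \<partial>law p)"
    by (subst nn_integral_resample[OF meas, of p]) (simp only: ind upd mult.assoc)
  also have "\<dots> = (\<integral>\<^sup>+x. indicator {t<..} x * (ennreal (exp (- t * sum rate P)) * ?g (x - t)) \<partial>law p)"
  proof (rule nn_integral_cong)
    fix x
    have "(\<integral>\<^sup>+\<xi>. indicator {t<..} x * (indicator {\<xi>. \<forall>q\<in>P. t < \<xi> q} \<xi> *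
         f ((elapse P t \<xi>)(p := x - t))) \<partial>clocks) =
       indicator {t<..} x * (\<integral>\<^sup>+\<xi>. (indicator {\<xi>. \<forall>q\<in>P. t < \<xi> q} \<xi> *
         f ((elapse P t \<xi>)(p := x - t))) \<partial>clocks)"
      by (rule nn_integral_cmult) measurable
    also have "\<dots> = indicator {t<..} x * (ennreal (exp (- t * sum rate P)) * ?g (x - t))"
      by (subst insert.IH[of "\<lambda>\<xi>. f (\<xi>(p := x - t))"]) simp_all
    finally show "(\<integral>\<^sup>+\<xi>. indicator {t<..} x * (indicator {\<xi>. \<forall>q\<in>P. t < \<xi> q} \<xi> *
         f ((elapse P t \<xi>)(p := x - t))) \<partial>clocks) =
       indicator {t<..} x * (ennreal (exp (- t * sum rate P)) * ?g (x - t))" .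
  qed
  also have "\<dots> = (\<integral>\<^sup>+x. ennreal (rate p * exp (- x * rate p)) * indicator {0..} x *
      (indicator {t<..} x * (ennreal (exp (- t * sum rate P)) * ?g (x - t))) \<partial>lborel)"
    by (rule nn_integral_law) measurable
  also have "\<dots> = (\<integral>\<^sup>+x. ennreal (rate p * exp (- (t + x) * rate p)) * indicator {0..} (t + x) *
      (indicator {t<..} (t + x) * (ennreal (exp (- t * sum rate P)) * ?g (t + x - t))) \<partial>lborel)"
    by (subst nn_integral_real_affine[of _ 1 t]) simp_all
  also have "\<dots> = (\<integral>\<^sup>+x. ennreal (exp (- t * (rate p + sum rate P))) *
      (ennreal (rate p * exp (- x * rate p)) * indicator {0..} x * ?g x) \<partial>lborel)"
  \<comment> \<open>At \<open>x = 0\<close> the indicators of \<open>{t<..}\<close> at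
    \<open>t + x\<close> and of \<open>{0..}\<close> at \<open>x\<close> disagree, so equality holds
    only almost everywhere.\<close>
  proof (rule nn_integral_cong_AE, use AE_lborel_singleton[of 0] in eventually_elim)
    fix x :: real assume "x \<noteq> 0"
    have "ennreal (rate p * exp (- (t + x) * rate p)) * ennreal (exp (- t * sum rate P)) =
        ennreal (exp (- t * (rate p + sum rate P))) * ennreal (rate p * exp (- x * rate p))"
      using rate_pos[of p]
      by (simp add: ennreal_mult[symmetric] mult.assoc mult_exp_exp)
         (simp add: algebra_simps mult_exp_exp)
    then show "ennreal (rate p * exp (- (t + x) * rate p)) * indicator {0..} (t + x) *
      (indicator {t<..} (t + x) * (ennreal (exp (- t * sum rate P)) * ?g (t + x - t))) =
       ennreal (exp (- t * (rate p + sum rate P))) *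
      (ennreal (rate p * exp (- x * rate p)) * indicator {0..} x * ?g x)"
      using \<open>x \<noteq> 0\<close> \<open>0 \<le> t\<close> by (auto simp: indicator_def mult.assoc[symmetric])
  qed
  also have "\<dots> = ennreal (exp (- t * (rate p + sum rate P))) * (\<integral>\<^sup>+x. ?g x \<partial>law p)"
    by (simp add: nn_integral_cmult nn_integral_law)
  also have "(\<integral>\<^sup>+x. ?g x \<partial>law p) = (\<integral>\<^sup>+\<xi>. f \<xi> \<partial>clocks)"
    by (rule nn_integral_resample[symmetric]) measurable
  finally show ?case using insert.hyps by simp
qed

text \<open>The density of the ringing time of \<open>q\<close> and the survival of the other clocks
  of \<open>P\<close> combine to the exponent \<open>sum rate P\<close>; the residual clocks are a
  fresh copy. The clock \<open>q\<close> itself is left at 0 rather than renewed, hence the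
  assumption that \<open>G t\<close> does not read it.\<close>

lemma nn_integral_first_clock:
  assumes "finite P" "q \<in> P"
    and G [measurable]: "(\<lambda>(t, \<xi>). G t \<xi>) \<in> borel_measurable (borel \<Otimes>\<^sub>M Pi\<^sub>M UNIV (\<lambda>_. borel))"
    and indep: "\<And>t x \<xi>. G t (\<xi>(q := x)) = G t \<xi>"
  shows "(\<integral>\<^sup>+\<xi>. indicator {\<xi>. \<forall>p\<in>P - {q}. \<xi> q < \<xi> p} \<xi> * G (\<xi> q) (elapse P (\<xi> q) \<xi>) \<partial>clocks) =
    (\<integral>\<^sup>+t. ennreal (rate q * exp (- t * sum rate P)) * indicator {0..} t *
       (\<integral>\<^sup>+\<xi>. G t \<xi> \<partial>clocks) \<partial>lborel)"
proof -
  let ?P = "P - {q}"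
  have [simp]: "finite ?P" using assms(1) by simp
  have G' [measurable (raw)]: "(\<lambda>x. G (f x) (g x)) \<in> borel_measurable N"
    if "f \<in> borel_measurable N" "g \<in> measurable N (Pi\<^sub>M UNIV (\<lambda>_. borel))" for f g N
    using measurable_compose[OF measurable_Pair[OF that] G] by simp
  have [simp]: "G t (elapse P t (\<xi>(q := t))) = G t (elapse ?P t \<xi>)" for t \<xi>
  proof -
    have "elapse P t (\<xi>(q := t)) = (elapse ?P t \<xi>)(q := 0)"
      using assms(2) by (auto simp: elapse_def)
    then show ?thesis by (simp add: indep)
  qed
  have [simp]: "indicator {\<xi>. \<forall>p\<in>?P. \<xi> q < \<xi> p} (\<xi>(q := t)) =
      (indicator {\<xi>. \<forall>p\<in>?P. t < \<xi> p} \<xi> :: ennreal)" for t \<xi>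
    by (auto simp: indicator_def)
  have [measurable]: "Measurable.pred (Pi\<^sub>M UNIV (\<lambda>_. borel)) (\<lambda>\<xi>. \<forall>p\<in>?P. \<xi> q < (\<xi> p :: real))"
    by (rule pred_all_gt) (simp_all add: measurable_apply_PiM assms(1))
  have [measurable]: "Measurable.pred (borel \<Otimes>\<^sub>M Pi\<^sub>M UNIV (\<lambda>_. borel)) (\<lambda>x. \<forall>p\<in>?P. fst x < (snd x p :: real))"
    by (rule pred_all_gt) (simp_all add: assms(1))
  have meas: "(\<lambda>\<xi>. indicator {\<xi>. \<forall>p\<in>?P. \<xi> q < \<xi> p} \<xi> * G (\<xi> q) (elapse P (\<xi> q) \<xi>))
      \<in> borel_measurable (Pi\<^sub>M UNIV (\<lambda>_. borel))"
    by measurable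
  have "(\<integral>\<^sup>+\<xi>. indicator {\<xi>. \<forall>p\<in>?P. \<xi> q < \<xi> p} \<xi> * G (\<xi> q) (elapse P (\<xi> q) \<xi>) \<partial>clocks) =
     (\<integral>\<^sup>+t. \<integral>\<^sup>+\<xi>. indicator {\<xi>. \<forall>p\<in>?P. t < \<xi> p} \<xi> * G t (elapse ?P t \<xi>) \<partial>clocks \<partial>law q)"
    by (subst nn_integral_resample[OF meas, of q]) simp
  also have "\<dots> = (\<integral>\<^sup>+t. ennreal (rate q * exp (- t * rate q)) * indicator {0..} t *
     (\<integral>\<^sup>+\<xi>. indicator {\<xi>. \<forall>p\<in>?P. t < \<xi> p} \<xi> * G t (elapse ?P t \<xi>) \<partial>clocks) \<partial>lborel)"
    by (rule nn_integral_law) measurable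
  also have "\<dots> = (\<integral>\<^sup>+t. ennreal (rate q * exp (- t * sum rate P)) * indicator {0..} t *
       (\<integral>\<^sup>+\<xi>. G t \<xi> \<partial>clocks) \<partial>lborel)"
  proof (rule nn_integral_cong)
    fix t :: real
    show "ennreal (rate q * exp (- t * rate q)) * indicator {0..} t *
       (\<integral>\<^sup>+\<xi>. indicator {\<xi>. \<forall>p\<in>?P. t < \<xi> p} \<xi> * G t (elapse ?P t \<xi>) \<partial>clocks) =
      ennreal (rate q * exp (- t * sum rate P)) * indicator {0..} t * (\<integral>\<^sup>+\<xi>. G t \<xi> \<partial>clocks)"
    proof (cases "0 \<le> t")
      case True
      have "ennreal (rate q * exp (- t * rate q)) * ennreal (exp (- t * sum rate ?P)) =
          ennreal (rate q * exp (- t * sum rate P))"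
        using rate_pos[of q] assms(1,2)
        by (simp add: ennreal_mult[symmetric] sum.remove[of P q] mult.assoc mult_exp_exp)
           (simp add: algebra_simps)
      then show ?thesis
        using True memoryless[of ?P t "G t"] assms(1) by (simp add: mult.assoc[symmetric])
    qed simp
  qed
  finally show ?thesis .
qed

end

section \<open>Runs in residual time\<close>

lemma arg_min_on_cong:
  assumes "\<And>x y. x \<in> S \<Longrightarrow> y \<in> S \<Longrightarrow> f x < f y \<longleftrightarrow> g x < g y"
  shows "arg_min_on f S = arg_min_on g S"
proof -
  have "is_arg_min f (\<lambda>x. x \<in> S) = is_arg_min g (\<lambda>x. x \<in> S)"
    using assms by (auto simp: is_arg_min_def fun_eq_iff)
  then show ?thesis by (simp add: arg_min_on_def arg_min_def)
qed

lemma arg_min_on_in: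
  fixes f :: "'a \<Rightarrow> 'b::linorder"
  assumes "finite S" "S \<noteq> {}"
  shows "arg_min_on f S \<in> S"
  using arg_min_if_finite(1)[OF assms] .

lemma arg_min_on_eq_iff:
  fixes f :: "'a \<Rightarrow> 'b::linorder"
  assumes "finite S" "inj_on f S" "x \<in> S"
  shows "arg_min_on f S = x \<longleftrightarrow> (\<forall>y\<in>S - {x}. f x < f y)"
proof
  assume *: "arg_min_on f S = x"
  show "\<forall>y\<in>S - {x}. f x < f y"
  proof
    fix y assume y: "y \<in> S - {x}"
    then have "f x \<le> f y"
      using arg_min_least[of S y f] * assms(1) by auto
    moreover have "f x \<noteq> f y" using y assms(2,3) by (auto dest: inj_onD)
    ultimately show "f x < f y" by simp
  qed
next
  assume *: "\<forall>y\<in>S - {x}. f x < f y"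
  have "f (arg_min_on f S) \<le> f x"
    by (rule arg_min_least) (use assms in auto)
  moreover have "arg_min_on f S \<in> S"
    using assms by (intro arg_min_on_in) auto
  ultimately show "arg_min_on f S = x"
    using * by (metis Diff_iff empty_iff insert_iff leD)
qed

section \<open>Configurations and the clocks they can still read\<close>

primrec clock_of :: "'n event \<Rightarrow> 'n clock" where
  "clock_of (Arrival i k) = Gap i k"
| "clock_of (Expiry i k) = Sojourn i k"

lemma inj_clock_of: "inj clock_of"
proof (rule injI)
  fix e e' :: "'n event" assume "clock_of e = clock_of e'"
  then show "e = e'" by (cases e; cases e') auto
qed

text \<open>The bound on the numbers ensures that the demand to arrive next is not waiting yet and
  that its sojourn clock is untouched.\<close>

definition wf_config :: "'n config \<Rightarrow> bool" where
  "wf_config \<sigma> \<longleftrightarrow> finite (snd \<sigma>) \<and> (\<forall>i k. (i, k) \<in> snd \<sigma> \<longrightarrow> k < fst \<sigma> i)"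

lemma wf_configD: "wf_config \<sigma> \<Longrightarrow> (i, k) \<in> snd \<sigma> \<Longrightarrow> k < fst \<sigma> i"
  by (simp add: wf_config_def)

text \<open>The clocks that a run from \<open>\<sigma>\<close> can still read.\<close>

definition live :: "'n config \<Rightarrow> 'n clock set" where
  "live \<sigma> = {q. case q of Gap i k \<Rightarrow> fst \<sigma> i \<le> k | Sojourn i k \<Rightarrow> fst \<sigma> i \<le> k \<or> (i, k) \<in> snd \<sigma>}"

lemma finite_pending: "wf_config (\<sigma> :: 'n::finite config) \<Longrightarrow> finite (pending \<sigma>)"
  by (simp add: wf_config_def pending_def)

lemma Arrival_in_pending [simp]: "Arrival i k \<in> pending \<sigma> \<longleftrightarrow> k = fst \<sigma> i"
  by (auto simp: pending_def)

lemma Expiry_in_pending [simp]: "Expiry i k \<in> pending \<sigma> \<longleftrightarrow> (i, k) \<in> snd \<sigma>"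
  by (auto simp: pending_def)

lemma pending_nonempty: "pending \<sigma> \<noteq> {}"
  by (simp add: pending_def)

lemma pending_subset_live: "clock_of ` pending \<sigma> \<subseteq> live \<sigma>"
  by (auto simp: pending_def live_def)

lemma wf_config_step:
  assumes "wf_config \<sigma>" "e \<in> pending \<sigma>"
  shows "wf_config (step \<phi> \<sigma> e)"
  using assms by (cases \<sigma>) (auto simp: wf_config_def pending_def less_Suc_eq split: option.splits)

text \<open>A clock that has rung is never read again, since arrival counts only increase and an
  expired demand leaves. This supplies the independence that \<open>nn_integral_first_clock\<close>
  asks for.\<close>

lemma live_step:
  assumes "wf_config \<sigma>" "e \<in> pending \<sigma>"
  shows "live (step \<phi> \<sigma> e) \<subseteq> live \<sigma> - {clock_of e}"
  using assms
  by (cases \<sigma>)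
     (auto simp: wf_config_def pending_def live_def split: option.splits clock.splits if_splits, blast dest: leD)

text \<open>A run of at most \<open>n\<close> events in terms of residual times: \<open>\<xi>\<close> assigns to the clock of
  each pending event the time left until it rings. It collects \<open>w\<close> for the events up to the
  horizon \<open>T\<close>, and \<open>z\<close> if all \<open>n\<close> events happen before it.\<close>

primrec run_value :: "'n policy \<Rightarrow> ('n config \<Rightarrow> 'n event \<Rightarrow> ennreal) \<Rightarrow> ennreal \<Rightarrow> nat \<Rightarrow>
    'n config \<Rightarrow> real \<Rightarrow> ('n clock \<Rightarrow> real) \<Rightarrow> ennreal" where
  "run_value \<phi> w z 0 \<sigma> T \<xi> = (if 0 \<le> T then z else 0)"
| "run_value \<phi> w z (Suc n) \<sigma> T \<xi> =
     (let e = arg_min_on (\<lambda>e. \<xi> (clock_of e)) (pending \<sigma>); t = \<xi> (clock_of e)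
      in (if t \<le> T then w \<sigma> e else 0) +
         run_value \<phi> w z n (step \<phi> \<sigma> e) (T - t) (elapse (clock_of ` pending \<sigma>) t \<xi>))"

lemma run_value_cong:
  fixes \<sigma> :: "'n::finite config"
  assumes "wf_config \<sigma>" "\<And>q. q \<in> live \<sigma> \<Longrightarrow> \<xi> q = \<xi>' q"
  shows "run_value \<phi> w z n \<sigma> T \<xi> = run_value \<phi> w z n \<sigma> T \<xi>'"
  using assms
proof (induction n arbitrary: \<sigma> T \<xi> \<xi>')
  case (Suc n)
  let ?e = "arg_min_on (\<lambda>e. \<xi> (clock_of e)) (pending \<sigma>)"
  have eq: "\<xi> (clock_of e) = \<xi>' (clock_of e)" if "e \<in> pending \<sigma>" for e
    using that Suc.prems(2) pending_subset_live[of \<sigma>] by auto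
  have e': "arg_min_on (\<lambda>e. \<xi>' (clock_of e)) (pending \<sigma>) = ?e"
    by (rule arg_min_on_cong) (simp add: eq)
  have e: "?e \<in> pending \<sigma>"
    by (intro arg_min_on_in finite_pending pending_nonempty Suc.prems)
  have "run_value \<phi> w z n (step \<phi> \<sigma> ?e) T' (elapse (clock_of ` pending \<sigma>) t \<xi>) =
      run_value \<phi> w z n (step \<phi> \<sigma> ?e) T' (elapse (clock_of ` pending \<sigma>) t \<xi>')" for T' t
    using live_step[OF Suc.prems(1) e] Suc.prems(2)
    by (intro Suc.IH wf_config_step e Suc.prems) (auto simp: elapse_def)
  then show ?case
    by (simp add: Let_def e' eq[OF e])
qed simp

text \<open>Splitting by the event that comes first lets each summand continue from a fixed
  configuration instead of a random one, so that it can be measured and integrated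
  separately.\<close>

lemma run_value_Suc_sum:
  fixes \<sigma> :: "'n::finite config"
  assumes "wf_config \<sigma>"
  shows "run_value \<phi> w z (Suc n) \<sigma> T \<xi> =
    (\<Sum>e\<in>pending \<sigma>. indicator {\<xi>. arg_min_on (\<lambda>e. \<xi> (clock_of e)) (pending \<sigma>) = e} \<xi> *
      ((if \<xi> (clock_of e) \<le> T then w \<sigma> e else 0) +
       run_value \<phi> w z n (step \<phi> \<sigma> e) (T - \<xi> (clock_of e))
         (elapse (clock_of ` pending \<sigma>) (\<xi> (clock_of e)) \<xi>)))"
proof -
  let ?e = "arg_min_on (\<lambda>e. \<xi> (clock_of e)) (pending \<sigma>)"
  have e: "?e \<in> pending \<sigma>"
    by (intro arg_min_on_in finite_pending pending_nonempty assms)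
  show ?thesis
    by (subst sum.remove[OF finite_pending[OF assms] e])
       (auto simp: Let_def indicator_def intro!: sum.neutral)
qed

text \<open>Horizon and clocks are arbitrary measurable functions because the recursion itself
  replaces them by quantities that depend on the sample point.\<close>

lemma measurable_run_value:
  fixes \<sigma> :: "'n::finite config"
  assumes "wf_config \<sigma>"
    and [measurable]: "f \<in> borel_measurable N" "g \<in> measurable N (Pi\<^sub>M UNIV (\<lambda>_. borel))"
  shows "(\<lambda>x. run_value \<phi> w z n \<sigma> (f x) (g x)) \<in> borel_measurable N"
  using assms
proof (induction n arbitrary: \<sigma> f g)
  case (Suc n)
  note [measurable] = Suc.prems(2,3)
  have [measurable]: "(\<lambda>x. g x q) \<in> borel_measurable N" for q
    by (rule measurable_apply_PiM) measurable
  have arg_min: "(\<lambda>x. arg_min_on (\<lambda>e. g x (clock_of e)) (pending \<sigma>)) \<in> measurable N (count_space UNIV)"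
    by (intro measurable_arg_min_on finite_pending Suc.prems) measurable
  have [measurable]: "Measurable.pred N (\<lambda>x. arg_min_on (\<lambda>e. g x (clock_of e)) (pending \<sigma>) = e)" for e
    using measurable_compose[OF arg_min, of "\<lambda>e'. e' = e" "count_space UNIV"] by simp
  have [measurable]: "(\<lambda>x. run_value \<phi> w z n (step \<phi> \<sigma> e) (f x - g x (clock_of e))
      (elapse (clock_of ` pending \<sigma>) (g x (clock_of e)) (g x))) \<in> borel_measurable N"
    if "e \<in> pending \<sigma>" for e
    by (intro Suc.IH wf_config_step that Suc.prems(1)) measurable
  show ?case
    unfolding run_value_Suc_sum[OF Suc.prems(1)]
    unfolding indicator_def mem_Collect_eq
    by (intro borel_measurable_sum borel_measurable_times_ennreal borel_measurable_add
        measurable_If measurable_const) measurable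
qed simp

section \<open>First-event recursion for expected runs\<close>

locale matching_rates =
  fixes \<theta> :: "'n::finite \<Rightarrow> real" and r :: "real ^ 'n"
  assumes \<theta>_pos: "0 < \<theta> i" and r_pos: "0 < r $ i"
begin

sublocale exponential_clocks "clock_rate \<theta> r"
proof
  show "0 < clock_rate \<theta> r q" for q
    by (cases q) (simp_all add: \<theta>_pos r_pos)
qed

abbreviation event_rate :: "'n event \<Rightarrow> real" where
  "event_rate e \<equiv> clock_rate \<theta> r (clock_of e)"

definition expected_run :: "'n policy \<Rightarrow> ('n config \<Rightarrow> 'n event \<Rightarrow> ennreal) \<Rightarrow> ennreal \<Rightarrow> nat \<Rightarrow>
    'n config \<Rightarrow> real \<Rightarrow> ennreal" where
  "expected_run \<phi> w z n \<sigma> T = (\<integral>\<^sup>+\<xi>. run_value \<phi> w z n \<sigma> T \<xi> \<partial>clock_space \<theta> r)"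

lemma clock_space_eq: "clock_space \<theta> r = clocks"
  by (simp add: clock_space_def)

lemma expected_run_0: "expected_run \<phi> w z 0 \<sigma> T = (if 0 \<le> T then z else 0)"
  by (simp add: expected_run_def clock_space_eq clocks.emeasure_space_1[simplified])

lemma measurable_expected_run:
  assumes "wf_config \<sigma>" "f \<in> borel_measurable N"
  shows "(\<lambda>x. expected_run \<phi> w z n \<sigma> (f x)) \<in> borel_measurable N"
  unfolding expected_run_def clock_space_eq
  using assms by (intro clocks.borel_measurable_nn_integral) (simp add: split_beta' measurable_run_value)

lemma AE_clocks_inj_on:
  assumes "finite P"
  shows "AE \<xi> in clocks. inj_on \<xi> P"
proof -
  have "AE \<xi> in clocks. \<forall>p\<in>P. \<forall>q\<in>P. p \<noteq> q \<longrightarrow> \<xi> p \<noteq> \<xi> q"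
    using assms AE_clocks_neq by (intro AE_finite_allI) (auto intro!: AE_I2 AE_impI)
  then show ?thesis
    by eventually_elim (auto simp: inj_on_def)
qed

lemma expected_run_Suc_aux:
  assumes wf: "wf_config \<sigma>"
  shows "expected_run \<phi> w z (Suc n) \<sigma> T =
    (\<Sum>e\<in>pending \<sigma>. \<integral>\<^sup>+t. ennreal (event_rate e * exp (- t * sum event_rate (pending \<sigma>))) *
      indicator {0..} t *
      ((if t \<le> T then w \<sigma> e else 0) + expected_run \<phi> w z n (step \<phi> \<sigma> e) (T - t)) \<partial>lborel)"
proof -
  let ?P = "clock_of ` pending \<sigma>"
  define G where "G e t \<xi> = (if t \<le> T then w \<sigma> e else 0) + run_value \<phi> w z n (step \<phi> \<sigma> e) (T - t) \<xi>" for e t \<xi>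
  have fin: "finite (pending \<sigma>)" by (rule finite_pending[OF wf])
  have rate: "sum (clock_rate \<theta> r) ?P = sum event_rate (pending \<sigma>)"
    by (rule sum.reindex_cong[OF inj_on_subset[OF inj_clock_of]]) auto
  have G: "(\<lambda>x. G e (f x) (g x)) \<in> borel_measurable N"
    if "e \<in> pending \<sigma>" and [measurable]: "f \<in> borel_measurable N" "g \<in> measurable N (Pi\<^sub>M UNIV (\<lambda>_. borel))"
    for e f g and N :: "'x measure"
    unfolding G_def
    using measurable_run_value[OF wf_config_step[OF wf that(1)], of "\<lambda>x. T - f x" N g]
    by measurable
  \<comment> \<open>The minimiser is characterised by strict inequalities only if no two pending
    clocks agree, which holds almost surely.\<close>
  have indicator_eq: "AE \<xi> in clocks. \<forall>e\<in>pending \<sigma>.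
      indicator {\<xi>. arg_min_on (\<lambda>e. \<xi> (clock_of e)) (pending \<sigma>) = e} \<xi> =
      (indicator {\<xi>. \<forall>p\<in>?P - {clock_of e}. \<xi> (clock_of e) < \<xi> p} \<xi> :: ennreal)"
  proof (rule eventually_mono[OF AE_clocks_inj_on[of ?P]], use fin in simp, intro ballI)
    fix \<xi> :: "'n clock \<Rightarrow> real" and e assume inj: "inj_on \<xi> ?P" and e: "e \<in> pending \<sigma>"
    have "inj_on (\<lambda>e. \<xi> (clock_of e)) (pending \<sigma>)"
      using comp_inj_on[OF inj_on_subset[OF inj_clock_of] inj] by (simp add: comp_def)
    from arg_min_on_eq_iff[OF fin this e]
    have "arg_min_on (\<lambda>e. \<xi> (clock_of e)) (pending \<sigma>) = e \<longleftrightarrow>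
        (\<forall>y\<in>pending \<sigma> - {e}. \<xi> (clock_of e) < \<xi> (clock_of y))" .
    also have "\<dots> \<longleftrightarrow>
        (\<forall>p\<in>?P - {clock_of e}. \<xi> (clock_of e) < \<xi> p)"
      by (auto simp: inj_eq[OF inj_clock_of])
    finally show "indicator {\<xi>. arg_min_on (\<lambda>e. \<xi> (clock_of e)) (pending \<sigma>) = e} \<xi> =
      (indicator {\<xi>. \<forall>p\<in>?P - {clock_of e}. \<xi> (clock_of e) < \<xi> p} \<xi> :: ennreal)"
      by (simp add: indicator_def)
  qed
  have "expected_run \<phi> w z (Suc n) \<sigma> T =
    (\<integral>\<^sup>+\<xi>. (\<Sum>e\<in>pending \<sigma>. indicator {\<xi>. \<forall>p\<in>?P - {clock_of e}. \<xi> (clock_of e) < \<xi> p} \<xi> *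
        G e (\<xi> (clock_of e)) (elapse ?P (\<xi> (clock_of e)) \<xi>)) \<partial>clocks)"
    unfolding expected_run_def clock_space_eq run_value_Suc_sum[OF wf] G_def
    by (rule nn_integral_cong_AE) (use indicator_eq in eventually_elim, auto intro!: sum.cong)
  also have "\<dots> = (\<Sum>e\<in>pending \<sigma>. \<integral>\<^sup>+\<xi>. indicator {\<xi>. \<forall>p\<in>?P - {clock_of e}. \<xi> (clock_of e) < \<xi> p} \<xi> *
        G e (\<xi> (clock_of e)) (elapse ?P (\<xi> (clock_of e)) \<xi>) \<partial>clocks)"
  proof (rule nn_integral_sum)
    fix e assume e: "e \<in> pending \<sigma>"
    have [measurable]: "(\<lambda>\<xi>. \<xi> q) \<in> borel_measurable clocks" for q
      by (rule measurable_apply_PiM) measurable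
    have "Measurable.pred clocks (\<lambda>\<xi>. \<forall>p\<in>?P - {clock_of e}. \<xi> (clock_of e) < \<xi> p)"
      by (rule pred_all_gt) (simp_all add: fin)
    moreover have "(\<lambda>\<xi>. G e (\<xi> (clock_of e)) (elapse ?P (\<xi> (clock_of e)) \<xi>)) \<in> borel_measurable clocks"
      by (rule G[OF e]) measurable
    ultimately show "(\<lambda>\<xi>. indicator {\<xi>. \<forall>p\<in>?P - {clock_of e}. \<xi> (clock_of e) < \<xi> p} \<xi> *
        G e (\<xi> (clock_of e)) (elapse ?P (\<xi> (clock_of e)) \<xi>)) \<in> borel_measurable clocks"
      by measurable
  qed
  also have "\<dots> = (\<Sum>e\<in>pending \<sigma>. \<integral>\<^sup>+t. ennreal (event_rate e * exp (- t * sum event_rate (pending \<sigma>))) *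
      indicator {0..} t * (\<integral>\<^sup>+\<xi>. G e t \<xi> \<partial>clocks) \<partial>lborel)"
  proof (rule sum.cong[OF refl])
    fix e assume e: "e \<in> pending \<sigma>"
    \<comment> \<open>The clock that rang is not live after the step, so the rest of the run ignores
      it.\<close>
    have "G e t (\<xi>(clock_of e := x)) = G e t \<xi>" for t x \<xi>
      unfolding G_def using live_step[OF wf e, of \<phi>]
      by (subst run_value_cong[OF wf_config_step[OF wf e], of \<phi> "\<xi>(clock_of e := x)" \<xi>]) auto
    then show "(\<integral>\<^sup>+\<xi>. indicator {\<xi>. \<forall>p\<in>?P - {clock_of e}. \<xi> (clock_of e) < \<xi> p} \<xi> *
        G e (\<xi> (clock_of e)) (elapse ?P (\<xi> (clock_of e)) \<xi>) \<partial>clocks) =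
      (\<integral>\<^sup>+t. ennreal (event_rate e * exp (- t * sum event_rate (pending \<sigma>))) *
      indicator {0..} t * (\<integral>\<^sup>+\<xi>. G e t \<xi> \<partial>clocks) \<partial>lborel)"
      using nn_integral_first_clock[of ?P "clock_of e" "G e"] e fin G[OF e, of fst _ snd]
      by (simp add: rate split_beta')
  qed
  also have "\<dots> = (\<Sum>e\<in>pending \<sigma>. \<integral>\<^sup>+t. ennreal (event_rate e * exp (- t * sum event_rate (pending \<sigma>))) *
      indicator {0..} t *
      ((if t \<le> T then w \<sigma> e else 0) + expected_run \<phi> w z n (step \<phi> \<sigma> e) (T - t)) \<partial>lborel)"
  proof (intro sum.cong refl nn_integral_cong arg_cong2[where f = "(*)"])
    fix e t assume e: "e \<in> pending \<sigma>"
    have "(\<lambda>\<xi>. run_value \<phi> w z n (step \<phi> \<sigma> e) (T - t) \<xi>) \<in> borel_measurable clocks"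
      by (intro measurable_run_value wf_config_step wf e) measurable
    then show "(\<integral>\<^sup>+\<xi>. G e t \<xi> \<partial>clocks) =
        (if t \<le> T then w \<sigma> e else 0) + expected_run \<phi> w z n (step \<phi> \<sigma> e) (T - t)"
      by (simp add: G_def nn_integral_add expected_run_def clock_space_eq
          clocks.emeasure_space_1[simplified])
  qed
  finally show ?thesis .
qed

text \<open>The recursion does not stop at the horizon. Waiting times are nonnegative almost surely,
  so a horizon once passed stays negative and nothing more is collected; the integral over the first
  event time can therefore be cut off at \<open>T\<close>.\<close>

lemma expected_run_negative:
  assumes "wf_config \<sigma>" "T < 0"
  shows "expected_run \<phi> w z n \<sigma> T = 0"
  using assms
proof (induction n arbitrary: \<sigma> T)
  case (Suc n)
  show ?case
    unfolding expected_run_Suc_aux[OF Suc.prems(1)]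
  proof (intro sum.neutral ballI)
    fix e assume e: "e \<in> pending \<sigma>"
    have "expected_run \<phi> w z n (step \<phi> \<sigma> e) (T - t) = 0" if "0 \<le> t" for t
      using that Suc.prems by (intro Suc.IH wf_config_step e) auto
    then have "(\<integral>\<^sup>+t. ennreal (event_rate e * exp (- t * sum event_rate (pending \<sigma>))) * indicator {0..} t *
        ((if t \<le> T then w \<sigma> e else 0) + expected_run \<phi> w z n (step \<phi> \<sigma> e) (T - t)) \<partial>lborel) =
      (\<integral>\<^sup>+(t::real). 0 \<partial>lborel)"
      using Suc.prems(2) by (intro nn_integral_cong) (auto simp: indicator_def)
    then show "(\<integral>\<^sup>+t. ennreal (event_rate e * exp (- t * sum event_rate (pending \<sigma>))) * indicator {0..} t *
        ((if t \<le> T then w \<sigma> e else 0) + expected_run \<phi> w z n (step \<phi> \<sigma> e) (T - t)) \<partial>lborel) = 0"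
      by simp
  qed
qed (simp add: expected_run_0)

lemma expected_run_Suc:
  assumes wf: "wf_config \<sigma>"
  shows "expected_run \<phi> w z (Suc n) \<sigma> T =
    (\<integral>\<^sup>+t. (\<Sum>e\<in>pending \<sigma>. ennreal (event_rate e * exp (- t * sum event_rate (pending \<sigma>))) *
      (w \<sigma> e + expected_run \<phi> w z n (step \<phi> \<sigma> e) (T - t))) * indicator {0..T} t \<partial>lborel)"
proof -
  have meas: "(\<lambda>t. expected_run \<phi> w z n (step \<phi> \<sigma> e) (T - t)) \<in> borel_measurable borel"
    if "e \<in> pending \<sigma>" for e
    by (intro measurable_expected_run wf_config_step wf that) measurable
  have "expected_run \<phi> w z (Suc n) \<sigma> T =
    (\<Sum>e\<in>pending \<sigma>. \<integral>\<^sup>+t. ennreal (event_rate e * exp (- t * sum event_rate (pending \<sigma>))) *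
      (w \<sigma> e + expected_run \<phi> w z n (step \<phi> \<sigma> e) (T - t)) * indicator {0..T} t \<partial>lborel)"
    unfolding expected_run_Suc_aux[OF wf]
    using expected_run_negative[OF wf_config_step[OF wf]]
    by (intro sum.cong refl nn_integral_cong) (auto simp: indicator_def)
  also have "\<dots> = (\<integral>\<^sup>+t. (\<Sum>e\<in>pending \<sigma>. ennreal (event_rate e * exp (- t * sum event_rate (pending \<sigma>))) *
      (w \<sigma> e + expected_run \<phi> w z n (step \<phi> \<sigma> e) (T - t)) * indicator {0..T} t) \<partial>lborel)"
    by (rule nn_integral_sum[symmetric]) (use meas in measurable)
  finally show ?thesis
    by (simp add: sum_distrib_right)
qed

end

section \<open>Drift bounds on expected costs\<close>

text \<open>Relates absolute event times to the residual ones after time \<open>t\<^sub>0\<close>.\<close>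

definition aligned :: "('n clock \<Rightarrow> real) \<Rightarrow> 'n config \<Rightarrow> real \<Rightarrow> ('n clock \<Rightarrow> real) \<Rightarrow> bool" where
  "aligned \<omega> \<sigma> t\<^sub>0 \<xi> \<longleftrightarrow>
     (\<forall>e\<in>pending \<sigma>. event_time \<omega> e = t\<^sub>0 + \<xi> (clock_of e)) \<and>
     (\<forall>q\<in>live \<sigma> - clock_of ` pending \<sigma>. \<xi> q = \<omega> q)"

abbreviation empty_config :: "'n config" where
  "empty_config \<equiv> (\<lambda>_. 0, {})"

lemma wf_empty_config: "wf_config empty_config"
  by (simp add: wf_config_def)

lemma aligned_empty_config: "aligned \<omega> empty_config 0 \<omega>"
  by (auto simp: aligned_def pending_def)

lemma pending_step_cases:
  assumes "wf_config \<sigma>" "e \<in> pending \<sigma>" "e' \<in> pending (step \<phi> \<sigma> e)"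
  obtains "e' \<in> pending \<sigma> - {e}"
  | i where "e = Arrival i (fst \<sigma> i)" "e' = Arrival i (Suc (fst \<sigma> i))"
  | i where "e = Arrival i (fst \<sigma> i)" "e' = Expiry i (fst \<sigma> i)"
  using assms
  by (cases \<sigma>; cases e; cases e') (auto simp: wf_config_def split: option.splits if_splits)

text \<open>Rules out that a clock already partly used up turns back into an untouched one, as the
  second half of \<open>aligned\<close> demands.\<close>

lemma pending_step_live:
  assumes "wf_config \<sigma>" "e \<in> pending \<sigma>" "e' \<in> pending \<sigma>" "clock_of e' \<in> live (step \<phi> \<sigma> e)"
  shows "e' \<in> pending (step \<phi> \<sigma> e)"
proof -
  have "e' \<noteq> e" using live_step[OF assms(1,2), of \<phi>] assms(4) by auto
  moreover have "\<not> fst \<sigma> i \<le> k" "\<not> Suc (fst \<sigma> i) \<le> k" if "(i, k) \<in> snd \<sigma>" for i k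
    using wf_configD[OF assms(1) that] by auto
  ultimately show ?thesis
    using assms(2-4)
    by (cases \<sigma>; cases e; cases e') (auto simp: live_def split: option.splits if_splits)
qed

text \<open>An event pending after the step either was pending before, and its clock has lost the
  elapsed time, or was created by the arrival just processed, and its untouched clock starts at that
  very moment.\<close>

lemma aligned_step:
  assumes wf: "wf_config \<sigma>" and al: "aligned \<omega> \<sigma> t\<^sub>0 \<xi>" and e: "e \<in> pending \<sigma>"
  shows "aligned \<omega> (step \<phi> \<sigma> e) (t\<^sub>0 + \<xi> (clock_of e)) (elapse (clock_of ` pending \<sigma>) (\<xi> (clock_of e)) \<xi>)"
  unfolding aligned_def
proof (intro conjI ballI)
  let ?\<xi> = "elapse (clock_of ` pending \<sigma>) (\<xi> (clock_of e)) \<xi>"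
  have time: "event_time \<omega> e' = t\<^sub>0 + \<xi> (clock_of e')" if "e' \<in> pending \<sigma>" for e'
    using al that by (auto simp: aligned_def)
  have fresh: "?\<xi> q = \<omega> q" if "q \<in> live \<sigma>" "q \<notin> clock_of ` pending \<sigma>" for q
    using al that by (auto simp: aligned_def elapse_def)
  fix e' assume "e' \<in> pending (step \<phi> \<sigma> e)"
  then show "event_time \<omega> e' = t\<^sub>0 + \<xi> (clock_of e) + ?\<xi> (clock_of e')"
  proof (cases rule: pending_step_cases[OF wf e, consumes 1])
    case 1
    then show ?thesis by (simp add: time elapse_def)
  next
    case (2 i)
    have "Gap i (Suc (fst \<sigma> i)) \<notin> clock_of ` pending \<sigma>"
      by (auto simp: pending_def)
    then have "?\<xi> (clock_of e') = \<omega> (clock_of e')"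
      using 2 by (intro fresh) (auto simp: live_def)
    moreover have "event_time \<omega> e' = event_time \<omega> e + \<omega> (clock_of e')"
      using 2 by simp
    ultimately show ?thesis
      using time[OF e] by simp
  next
    case (3 i)
    have "Sojourn i (fst \<sigma> i) \<notin> clock_of ` pending \<sigma>"
      by (auto simp: pending_def dest: wf_configD[OF wf])
    then have "?\<xi> (clock_of e') = \<omega> (clock_of e')"
      using 3 by (intro fresh) (auto simp: live_def)
    moreover have "event_time \<omega> e' = event_time \<omega> e + \<omega> (clock_of e')"
      using 3 by simp
    ultimately show ?thesis
      using time[OF e] by simp
  qed
next
  let ?\<xi> = "elapse (clock_of ` pending \<sigma>) (\<xi> (clock_of e)) \<xi>"
  fix q assume q: "q \<in> live (step \<phi> \<sigma> e) - clock_of ` pending (step \<phi> \<sigma> e)"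
  then have "q \<in> live \<sigma>" "q \<notin> clock_of ` pending \<sigma>"
    using live_step[OF wf e, of \<phi>] pending_step_live[OF wf e, of _ \<phi>] by auto
  then show "?\<xi> q = \<omega> q"
    using al by (auto simp: aligned_def elapse_def)
qed

text \<open>Both formulations select the same next event, because absolute and residual times of
  pending events differ by the common shift \<open>t\<^sub>0\<close>.\<close>

lemma run_value_aligned:
  fixes \<sigma> :: "'n::finite config"
  assumes "wf_config \<sigma>" "aligned \<omega> \<sigma> t\<^sub>0 \<xi>"
  shows "run_value \<phi> w 0 n \<sigma> (T - t\<^sub>0) \<xi> =
    (\<Sum>m<n. let \<sigma>' = ((\<lambda>\<sigma>. step \<phi> \<sigma> (next_event \<omega> \<sigma>)) ^^ m) \<sigma>; e = next_event \<omega> \<sigma>'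
            in if event_time \<omega> e \<le> T then w \<sigma>' e else 0)"
  using assms
proof (induction n arbitrary: \<sigma> t\<^sub>0 \<xi>)
  case (Suc n)
  let ?S = "\<lambda>\<sigma>. step \<phi> \<sigma> (next_event \<omega> \<sigma>)" and ?e = "next_event \<omega> \<sigma>"
  have time: "event_time \<omega> e = t\<^sub>0 + \<xi> (clock_of e)" if "e \<in> pending \<sigma>" for e
    using Suc.prems(2) that by (simp add: aligned_def)
  have next_event: "arg_min_on (\<lambda>e. \<xi> (clock_of e)) (pending \<sigma>) = ?e"
    unfolding next_event_def by (rule arg_min_on_cong) (simp add: time)
  have e: "?e \<in> pending \<sigma>"
    unfolding next_event_def by (intro arg_min_on_in finite_pending pending_nonempty Suc.prems)
  have "run_value \<phi> w 0 n (?S \<sigma>) (T - (t\<^sub>0 + \<xi> (clock_of ?e)))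
      (elapse (clock_of ` pending \<sigma>) (\<xi> (clock_of ?e)) \<xi>) =
    (\<Sum>m<n. let \<sigma>' = (?S ^^ m) (?S \<sigma>); e = next_event \<omega> \<sigma>'
            in if event_time \<omega> e \<le> T then w \<sigma>' e else 0)"
    by (intro Suc.IH wf_config_step aligned_step e Suc.prems)
  moreover have "(\<Sum>m<Suc n. F ((?S ^^ m) \<sigma>)) = F \<sigma> + (\<Sum>m<n. F ((?S ^^ m) (?S \<sigma>)))"
    for F :: "'n config \<Rightarrow> ennreal"
    by (simp add: sum.lessThan_Suc_shift funpow_Suc_right del: sum.lessThan_Suc funpow.simps(2))
  note this[of "\<lambda>\<sigma>'. if event_time \<omega> (next_event \<omega> \<sigma>') \<le> T then w \<sigma>' (next_event \<omega> \<sigma>') else 0"]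
  ultimately show ?case
    by (simp add: Let_def next_event time[OF e] diff_diff_add del: sum.lessThan_Suc funpow.simps)
qed simp

lemma config_after_eq_funpow:
  "config_after \<phi> \<omega> m = ((\<lambda>\<sigma>. step \<phi> \<sigma> (next_event \<omega> \<sigma>)) ^^ m) empty_config"
  by (induction m) simp_all

lemma total_cost_eq_SUP:
  "total_cost c1 c2 \<phi> T \<omega> =
    (SUP n. run_value \<phi> (\<lambda>\<sigma> e. ennreal (event_cost c1 c2 \<phi> \<sigma> e)) 0 n
       (empty_config :: 'n::finite config) T \<omega>)"
  using run_value_aligned[OF wf_empty_config aligned_empty_config, of \<phi> _ _ T \<omega>]
  by (simp add: total_cost_def suminf_eq_SUP config_after_eq_funpow)

lemma incseq_run_value:
  "incseq (\<lambda>n. run_value \<phi> w 0 n (empty_config :: 'n::finite config) T \<omega>)"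
  using run_value_aligned[OF wf_empty_config aligned_empty_config, of \<phi> w _ T \<omega>]
  by (auto simp: incseq_def intro!: sum_mono2)

text \<open>With no costs and terminal value 1, a run of positive length is the indicator that its
  \<open>n\<close>-th event happens within the horizon. In expectation the terminal value thus
  contributes \<open>z\<close> times a probability.\<close>

lemma run_value_linear:
  "run_value \<phi> w z n \<sigma> T \<xi> = run_value \<phi> w 0 n \<sigma> T \<xi> + z * run_value \<phi> (\<lambda>_ _. 0) 1 n \<sigma> T \<xi>"
  by (induction n arbitrary: \<sigma> T \<xi>) (simp_all add: Let_def add.assoc)

lemma run_value_le_1: "run_value \<phi> (\<lambda>_ _. 0) 1 n \<sigma> T \<xi> \<le> 1"
  by (induction n arbitrary: \<sigma> T \<xi>) (simp_all add: Let_def)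

section \<open>Integral inequalities for the first event\<close>

lemma ennreal_integral_le_nn_integral:
  assumes "integrable M f"
  shows "ennreal (\<integral>x. f x \<partial>M) \<le> (\<integral>\<^sup>+x. ennreal (f x) \<partial>M)"
proof -
  have "ennreal (\<integral>x. f x \<partial>M) \<le> ennreal (\<integral>x. max 0 (f x) \<partial>M)"
    using assms by (intro ennreal_leI integral_mono) auto
  also have "\<dots> = (\<integral>\<^sup>+x. ennreal (max 0 (f x)) \<partial>M)"
    using assms by (intro nn_integral_eq_integral[symmetric]) auto
  also have "\<dots> = (\<integral>\<^sup>+x. ennreal (f x) \<partial>M)"
    by (simp add: max_def ennreal_neg cong: if_cong) (auto intro!: nn_integral_cong simp: ennreal_neg)
  finally show ?thesis .
qed

text \<open>The integrand is the derivative of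
  \<open>- exp (- t * L) * (h + \<rho> * (T - t))\<close>. The boundary term
  \<open>exp (- T * L) * h\<close> belongs to the case of no event by time \<open>T\<close>.\<close>

lemma has_bochner_integral_discounted:
  fixes L \<rho> h T :: real
  assumes "0 \<le> T"
  shows "has_bochner_integral lborel
    (\<lambda>t. exp (- t * L) * (\<rho> + L * (h + \<rho> * (T - t))) * indicator {0..T} t)
    (h + \<rho> * T - exp (- T * L) * h)"
proof -
  have "has_bochner_integral lborel
    (\<lambda>t. exp (- t * L) * (\<rho> + L * (h + \<rho> * (T - t))) * indicator {0..T} t)
    (- exp (- T * L) * (h + \<rho> * (T - T)) - (- exp (- 0 * L) * (h + \<rho> * (T - 0))))"
    using assms
    by (intro has_bochner_integral_FTC_Icc_real[where F = "\<lambda>t. - exp (- t * L) * (h + \<rho> * (T - t))"])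
       (auto intro!: derivative_eq_intros continuous_intros simp: algebra_simps)
  then show ?thesis by (simp add: algebra_simps)
qed

lemma discounted_sum:
  fixes c a :: "'e \<Rightarrow> real"
  shows "(\<Sum>e\<in>S. (c e * x) * (a e + y)) = x * ((\<Sum>e\<in>S. c e * a e) + sum c S * y)"
  by (simp add: sum_distrib_left sum_distrib_right sum.distrib algebra_simps)

lemma sum_mult_ennreal:
  assumes "\<And>e. e \<in> S \<Longrightarrow> 0 \<le> f e" "\<And>e. e \<in> S \<Longrightarrow> 0 \<le> g e"
  shows "(\<Sum>e\<in>S. ennreal (f e) * ennreal (g e)) = ennreal (\<Sum>e\<in>S. f e * g e)"
  using assms by (simp add: ennreal_mult[symmetric] sum_ennreal)

lemma one_step_le:
  fixes c a :: "'e \<Rightarrow> real"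
  assumes "finite S" "\<And>e. e \<in> S \<Longrightarrow> 0 < c e" "\<And>e. e \<in> S \<Longrightarrow> 0 \<le> a e"
    and "0 \<le> \<rho>" "0 \<le> h" "0 \<le> T"
    and drift: "(\<Sum>e\<in>S. c e * a e) \<le> \<rho> + sum c S * h"
    and f: "\<And>e t. e \<in> S \<Longrightarrow> 0 \<le> t \<Longrightarrow> t \<le> T \<Longrightarrow> f e t \<le> ennreal (a e + \<rho> * (T - t))"
  shows "(\<integral>\<^sup>+t. (\<Sum>e\<in>S. ennreal (c e * exp (- t * sum c S)) * f e t) * indicator {0..T} t \<partial>lborel)
    \<le> ennreal (h + \<rho> * T)"
proof -
  let ?L = "sum c S"
  let ?g = "\<lambda>t. exp (- t * ?L) * (\<rho> + ?L * (h + \<rho> * (T - t))) * indicator {0..T} t"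
  have L: "0 \<le> ?L" using assms(2) by (simp add: sum_nonneg less_imp_le)
  have "(\<integral>\<^sup>+t. (\<Sum>e\<in>S. ennreal (c e * exp (- t * ?L)) * f e t) * indicator {0..T} t \<partial>lborel)
      \<le> (\<integral>\<^sup>+t. ennreal (?g t) \<partial>lborel)"
  proof (rule nn_integral_mono)
    fix t :: real
    show "(\<Sum>e\<in>S. ennreal (c e * exp (- t * ?L)) * f e t) * indicator {0..T} t \<le> ennreal (?g t)"
    proof (cases "t \<in> {0..T}")
      case True
      then have "(\<Sum>e\<in>S. ennreal (c e * exp (- t * ?L)) * f e t) \<le>
          (\<Sum>e\<in>S. ennreal (c e * exp (- t * ?L)) * ennreal (a e + \<rho> * (T - t)))"
        by (intro sum_mono mult_left_mono f) auto
      also have "\<dots> = ennreal (\<Sum>e\<in>S. (c e * exp (- t * ?L)) * (a e + \<rho> * (T - t)))"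
        using True assms(2,3,4) by (intro sum_mult_ennreal) (auto simp: less_imp_le)
      also have "\<dots> \<le> ennreal (exp (- t * ?L) * (\<rho> + ?L * (h + \<rho> * (T - t))))"
        unfolding discounted_sum using drift
        by (intro ennreal_leI mult_left_mono) (auto simp: algebra_simps)
      finally show ?thesis using True by simp
    qed simp
  qed
  also have "\<dots> = ennreal (h + \<rho> * T - exp (- T * ?L) * h)"
    using has_bochner_integral_discounted[OF \<open>0 \<le> T\<close>, of ?L \<rho> h] assms L
    by (subst nn_integral_eq_integral) (auto simp: has_bochner_integral_iff indicator_def)
  also have "\<dots> \<le> ennreal (h + \<rho> * T)"
    using \<open>0 \<le> h\<close> by (intro ennreal_leI) simp
  finally show ?thesis .
qed

lemma one_step_ge:
  fixes c a :: "'e \<Rightarrow> real"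
  assumes "finite S" "\<And>e. e \<in> S \<Longrightarrow> 0 < c e"
    and "h \<le> 0" "0 \<le> T"
    and drift: "\<rho> + sum c S * h \<le> (\<Sum>e\<in>S. c e * a e)"
    and f: "\<And>e t. e \<in> S \<Longrightarrow> 0 \<le> t \<Longrightarrow> t \<le> T \<Longrightarrow> ennreal (a e + \<rho> * (T - t)) \<le> f e t"
  shows "ennreal (h + \<rho> * T) \<le>
    (\<integral>\<^sup>+t. (\<Sum>e\<in>S. ennreal (c e * exp (- t * sum c S)) * f e t) * indicator {0..T} t \<partial>lborel)"
proof -
  let ?L = "sum c S"
  let ?g = "\<lambda>t. exp (- t * ?L) * (\<rho> + ?L * (h + \<rho> * (T - t))) * indicator {0..T} t"
  have "ennreal (h + \<rho> * T) \<le> ennreal (h + \<rho> * T - exp (- T * ?L) * h)"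
    using \<open>h \<le> 0\<close> by (intro ennreal_leI) (simp add: mult_nonneg_nonpos)
  also have "\<dots> \<le> (\<integral>\<^sup>+t. ennreal (?g t) \<partial>lborel)"
    using has_bochner_integral_discounted[OF \<open>0 \<le> T\<close>, of ?L \<rho> h]
      ennreal_integral_le_nn_integral[of lborel ?g]
    by (simp add: has_bochner_integral_iff)
  also have "\<dots> \<le> (\<integral>\<^sup>+t. (\<Sum>e\<in>S. ennreal (c e * exp (- t * ?L)) * f e t) * indicator {0..T} t \<partial>lborel)"
  proof (rule nn_integral_mono)
    fix t :: real
    show "ennreal (?g t) \<le> (\<Sum>e\<in>S. ennreal (c e * exp (- t * ?L)) * f e t) * indicator {0..T} t"
    proof (cases "t \<in> {0..T}")
      case True
      have "ennreal (exp (- t * ?L) * (\<rho> + ?L * (h + \<rho> * (T - t)))) \<le>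
          ennreal (\<Sum>e\<in>S. (c e * exp (- t * ?L)) * (a e + \<rho> * (T - t)))"
        unfolding discounted_sum using drift
        by (intro ennreal_leI mult_left_mono) (auto simp: algebra_simps)
      \<comment> \<open>Single summands may be negative, where \<open>ennreal\<close> gives 0;
        passing to positive parts lets the sum be split termwise.\<close>
      also have "\<dots> \<le> ennreal (\<Sum>e\<in>S. (c e * exp (- t * ?L)) * max 0 (a e + \<rho> * (T - t)))"
        using assms(2) by (intro ennreal_leI sum_mono mult_left_mono) (auto simp: less_imp_le)
      also have "\<dots> = (\<Sum>e\<in>S. ennreal (c e * exp (- t * ?L)) * ennreal (max 0 (a e + \<rho> * (T - t))))"
        using assms(2) by (intro sum_mult_ennreal[symmetric]) (auto simp: less_imp_le)
      also have "\<dots> \<le> (\<Sum>e\<in>S. ennreal (c e * exp (- t * ?L)) * f e t)"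
        using True f by (intro sum_mono mult_left_mono) (auto simp: max_def ennreal_neg)
      finally show ?thesis using True by simp
    qed simp
  qed
  finally show ?thesis .
qed

section \<open>Drift criteria for expected costs\<close>

context matching_rates
begin

lemma event_rate_pos: "0 < event_rate e"
  by (rule rate_pos)

lemma expected_run_linear:
  assumes "wf_config \<sigma>"
  shows "expected_run \<phi> w z n \<sigma> T =
    expected_run \<phi> w 0 n \<sigma> T + z * expected_run \<phi> (\<lambda>_ _. 0) 1 n \<sigma> T"
proof -
  have [measurable]: "run_value \<phi> w z n \<sigma> T \<in> borel_measurable clocks" for w z
    by (intro measurable_run_value assms) measurable
  show ?thesis
    unfolding expected_run_def clock_space_eq
    by (subst nn_integral_cong[OF run_value_linear]) (simp add: nn_integral_add nn_integral_cmult)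
qed

lemma expected_run_le_1: "expected_run \<phi> (\<lambda>_ _. 0) 1 n \<sigma> T \<le> 1"
proof -
  have "expected_run \<phi> (\<lambda>_ _. 0) 1 n \<sigma> T \<le> (\<integral>\<^sup>+\<xi>. 1 \<partial>clocks)"
    unfolding expected_run_def clock_space_eq by (intro nn_integral_mono run_value_le_1)
  then show ?thesis by (simp add: clocks.emeasure_space_1[simplified])
qed

lemma expected_total_cost:
  "(\<integral>\<^sup>+\<omega>. total_cost c1 c2 \<phi> T \<omega> \<partial>clock_space \<theta> r) =
    (SUP n. expected_run \<phi> (\<lambda>\<sigma> e. ennreal (event_cost c1 c2 \<phi> \<sigma> e)) 0 n empty_config T)"
  unfolding total_cost_eq_SUP expected_run_def clock_space_eq
proof (rule nn_integral_monotone_convergence_SUP)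
  show "incseq (\<lambda>n \<xi>. run_value \<phi> (\<lambda>\<sigma> e. ennreal (event_cost c1 c2 \<phi> \<sigma> e)) 0 n empty_config T \<xi>)"
    by (rule incseq_SucI, rule le_funI, rule incseq_SucD[OF incseq_run_value])
qed (intro measurable_run_value wf_empty_config, measurable)

text \<open>The invariant \<open>I\<close> confines the drift condition to configurations that the
  policy reaches; the greedy policy satisfies it only there.\<close>

lemma expected_run_le:
  assumes inv: "\<And>\<sigma>. I \<sigma> \<Longrightarrow> wf_config \<sigma>" "\<And>\<sigma> e. I \<sigma> \<Longrightarrow> e \<in> pending \<sigma> \<Longrightarrow> I (step \<phi> \<sigma> e)"
    and nonneg: "\<And>\<sigma> e. 0 \<le> w \<sigma> e" "\<And>\<sigma>. 0 \<le> h \<sigma>" "0 \<le> \<rho>"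
    and drift: "\<And>\<sigma>. I \<sigma> \<Longrightarrow> (\<Sum>e\<in>pending \<sigma>. event_rate e * (w \<sigma> e + h (step \<phi> \<sigma> e))) \<le>
      \<rho> + sum event_rate (pending \<sigma>) * h \<sigma>"
    and "I \<sigma>" "0 \<le> T"
  shows "expected_run \<phi> (\<lambda>\<sigma> e. ennreal (w \<sigma> e)) 0 n \<sigma> T \<le> ennreal (h \<sigma> + \<rho> * T)"
  using assms(7-)
proof (induction n arbitrary: \<sigma> T)
  case (Suc n)
  show ?case
    unfolding expected_run_Suc[OF inv(1)[OF Suc.prems(1)]]
  proof (rule one_step_le[OF _ _ _ nonneg(3,2) Suc.prems(2) drift[OF Suc.prems(1)]])
    fix e t assume e: "e \<in> pending \<sigma>" and t: "0 \<le> t" "t \<le> T"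
    have "expected_run \<phi> (\<lambda>\<sigma> e. ennreal (w \<sigma> e)) 0 n (step \<phi> \<sigma> e) (T - t) \<le>
        ennreal (h (step \<phi> \<sigma> e) + \<rho> * (T - t))"
      using t by (intro Suc.IH inv(2) Suc.prems e) auto
    then have "ennreal (w \<sigma> e) + expected_run \<phi> (\<lambda>\<sigma> e. ennreal (w \<sigma> e)) 0 n (step \<phi> \<sigma> e) (T - t) \<le>
        ennreal (w \<sigma> e) + ennreal (h (step \<phi> \<sigma> e) + \<rho> * (T - t))"
      by (rule add_left_mono)
    also have "\<dots> = ennreal (w \<sigma> e + h (step \<phi> \<sigma> e) + \<rho> * (T - t))"
      using nonneg t by (simp add: ennreal_plus[symmetric] add.assoc del: ennreal_plus)
    finally show "ennreal (w \<sigma> e) + expected_run \<phi> (\<lambda>\<sigma> e. ennreal (w \<sigma> e)) 0 n (step \<phi> \<sigma> e) (T - t) \<le>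
        ennreal (w \<sigma> e + h (step \<phi> \<sigma> e) + \<rho> * (T - t))" .
  qed (simp_all add: finite_pending[OF inv(1)[OF Suc.prems(1)]] event_rate_pos nonneg)
qed (simp add: expected_run_0)

text \<open>The terminal reward \<open>\<rho> * T\<^sub>0\<close> makes the bound hold for runs stopped after \<open>n\<close> events; it
  vanishes as \<open>n\<close> grows, because the process does not explode.\<close>

lemma expected_run_ge:
  assumes nonneg: "\<And>\<sigma> e. 0 \<le> w \<sigma> e" "\<And>\<sigma>. h \<sigma> \<le> 0" "0 \<le> \<rho>"
    and drift: "\<And>\<sigma>. wf_config \<sigma> \<Longrightarrow> \<rho> + sum event_rate (pending \<sigma>) * h \<sigma> \<le>
      (\<Sum>e\<in>pending \<sigma>. event_rate e * (w \<sigma> e + h (step \<phi> \<sigma> e)))"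
    and "wf_config \<sigma>" "0 \<le> T" "T \<le> T\<^sub>0"
  shows "ennreal (h \<sigma> + \<rho> * T) \<le> expected_run \<phi> (\<lambda>\<sigma> e. ennreal (w \<sigma> e)) (ennreal (\<rho> * T\<^sub>0)) n \<sigma> T"
  using assms(5-)
proof (induction n arbitrary: \<sigma> T)
  case 0
  have "h \<sigma> + \<rho> * T \<le> \<rho> * T\<^sub>0"
    using nonneg(2)[of \<sigma>] mult_left_mono[OF 0(3) nonneg(3)] by simp
  with 0 show ?case by (simp add: expected_run_0 ennreal_leI)
next
  case (Suc n)
  let ?E = "expected_run \<phi> (\<lambda>\<sigma> e. ennreal (w \<sigma> e)) (ennreal (\<rho> * T\<^sub>0)) n"
  show ?case
    unfolding expected_run_Suc[OF Suc.prems(1)]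
  proof (rule one_step_ge[OF finite_pending[OF Suc.prems(1)] event_rate_pos nonneg(2) Suc.prems(2)
        drift[OF Suc.prems(1)]])
    fix e t assume e: "e \<in> pending \<sigma>" and t: "0 \<le> t" "t \<le> T"
    let ?x = "h (step \<phi> \<sigma> e) + \<rho> * (T - t)"
    have "ennreal (w \<sigma> e + h (step \<phi> \<sigma> e) + \<rho> * (T - t)) \<le> ennreal (w \<sigma> e + max 0 ?x)"
      by (intro ennreal_leI) simp
    also have "\<dots> = ennreal (w \<sigma> e) + ennreal ?x"
      using nonneg(1)[of \<sigma> e] by (simp add: max_def ennreal_neg ennreal_plus)
    also have "\<dots> \<le> ennreal (w \<sigma> e) + ?E (step \<phi> \<sigma> e) (T - t)"
      using t Suc.prems by (intro add_left_mono Suc.IH wf_config_step e) auto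
    finally show "ennreal (w \<sigma> e + h (step \<phi> \<sigma> e) + \<rho> * (T - t)) \<le>
        ennreal (w \<sigma> e) + ?E (step \<phi> \<sigma> e) (T - t)" .
  qed
qed

lemma pending_eq:
  "pending \<sigma> = (\<lambda>i. Arrival i (fst \<sigma> i)) ` UNIV \<union> (\<lambda>(i, k). Expiry i k) ` snd \<sigma>"
  by (simp add: pending_def)

lemma sum_pending:
  fixes f :: "'n event \<Rightarrow> real"
  assumes "wf_config \<sigma>"
  shows "(\<Sum>e\<in>pending \<sigma>. event_rate e * f e) =
    (\<Sum>i\<in>UNIV. r $ i * f (Arrival i (fst \<sigma> i))) + (\<Sum>(i, k)\<in>snd \<sigma>. \<theta> i * f (Expiry i k))"
proof -
  have fin: "finite (snd \<sigma>)" using assms by (simp add: wf_config_def)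
  have inj: "inj (\<lambda>i. Arrival i (fst \<sigma> i))" "inj_on (\<lambda>(i, k). Expiry i k) (snd \<sigma>)"
    by (auto simp: inj_on_def)
  show ?thesis
    unfolding pending_eq
    by (subst sum.union_disjoint)
       (auto simp: fin sum.reindex[OF inj(1)] sum.reindex[OF inj(2)] intro!: sum.cong)
qed

text \<open>A Markov bound: a demand causes at most an arrival and an expiry, so the expected number
  of events is at most the number waiting plus twice the expected number of arrivals. The proof is a
  drift argument with unit cost per event and the number waiting as potential: expiries balance
  exactly, arrivals add at most 2.\<close>

lemma expected_run_nonexplosive:
  assumes "wf_config \<sigma>" "0 \<le> T"
  shows "of_nat n * expected_run \<phi> (\<lambda>_ _. 0) 1 n \<sigma> T \<le>
    ennreal (real (card (snd \<sigma>)) + 2 * (\<Sum>i\<in>UNIV. r $ i) * T)"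
  using assms
proof (induction n arbitrary: \<sigma> T)
  case (Suc n)
  let ?E = "expected_run \<phi> (\<lambda>_ _. 0) 1 n" and ?\<rho> = "2 * (\<Sum>i\<in>UNIV. r $ i)"
  let ?h = "\<lambda>\<sigma>. real (card (snd \<sigma>))"
  let ?c = "\<lambda>e t. ennreal (event_rate e * exp (- t * sum event_rate (pending \<sigma>)))"
  have wf: "wf_config \<sigma>" and fin: "finite (snd \<sigma>)"
    using Suc.prems by (simp_all add: wf_config_def)
  have meas: "(\<lambda>t. ?E (step \<phi> \<sigma> e) (T - t)) \<in> borel_measurable borel" if "e \<in> pending \<sigma>" for e
    by (intro measurable_expected_run wf_config_step wf that) measurable
  have \<rho>: "0 \<le> ?\<rho>" using r_pos by (simp add: sum_nonneg less_imp_le)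
  have "of_nat (Suc n) * expected_run \<phi> (\<lambda>_ _. 0) 1 (Suc n) \<sigma> T =
      (\<integral>\<^sup>+t. of_nat (Suc n) * ((\<Sum>e\<in>pending \<sigma>. ?c e t * (0 + ?E (step \<phi> \<sigma> e) (T - t))) * indicator {0..T} t) \<partial>lborel)"
    unfolding expected_run_Suc[OF wf]
    by (rule nn_integral_cmult[symmetric]) (use meas in measurable)
  also have "\<dots> = (\<integral>\<^sup>+t. (\<Sum>e\<in>pending \<sigma>. ?c e t * (of_nat (Suc n) * ?E (step \<phi> \<sigma> e) (T - t))) * indicator {0..T} t \<partial>lborel)"
    by (intro nn_integral_cong) (simp add: sum_distrib_left sum_distrib_right mult_ac)
  also have "\<dots> \<le> ennreal (?h \<sigma> + ?\<rho> * T)"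
  proof (rule one_step_le[where a = "\<lambda>e. 1 + ?h (step \<phi> \<sigma> e)"])
    fix e t assume e: "e \<in> pending \<sigma>" and t: "0 \<le> t" "t \<le> T"
    \<comment> \<open>One of the \<open>Suc n\<close> copies of the probability is bounded by 1 and
      pays for the current event; the other \<open>n\<close> go to the induction hypothesis.\<close>
    have "of_nat (Suc n) * ?E (step \<phi> \<sigma> e) (T - t) =
        ?E (step \<phi> \<sigma> e) (T - t) + of_nat n * ?E (step \<phi> \<sigma> e) (T - t)"
      by (simp add: distrib_right)
    also have "\<dots> \<le> 1 + ennreal (?h (step \<phi> \<sigma> e) + ?\<rho> * (T - t))"
      using t by (intro add_mono expected_run_le_1 Suc.IH wf_config_step wf e) auto
    also have "\<dots> = ennreal (1 + ?h (step \<phi> \<sigma> e) + ?\<rho> * (T - t))"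
      using \<rho> t by (simp add: ennreal_1[symmetric] ennreal_plus[symmetric] add.assoc del: ennreal_plus ennreal_1)
    finally show "of_nat (Suc n) * ?E (step \<phi> \<sigma> e) (T - t) \<le>
        ennreal (1 + ?h (step \<phi> \<sigma> e) + ?\<rho> * (T - t))" .
  next
    have arrival: "?h (step \<phi> \<sigma> (Arrival i (fst \<sigma> i))) \<le> ?h \<sigma> + 1" for i
    proof -
      have "card (snd (step \<phi> \<sigma> (Arrival i (fst \<sigma> i)))) \<le> Suc (card (snd \<sigma>))"
        using fin by (cases \<sigma>) (auto split: option.split intro: le_SucI card_Diff1_le simp: card_insert_if)
      then show ?thesis by simp
    qed
    have expiry: "1 + ?h (step \<phi> \<sigma> (Expiry i k)) = ?h \<sigma>" if "(i, k) \<in> snd \<sigma>" for i k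
      using that fin card_Suc_Diff1[OF fin that] by (cases \<sigma>) simp
    have "(\<Sum>e\<in>pending \<sigma>. event_rate e * (1 + ?h (step \<phi> \<sigma> e))) =
      (\<Sum>i\<in>UNIV. r $ i * (1 + ?h (step \<phi> \<sigma> (Arrival i (fst \<sigma> i))))) +
      (\<Sum>(i, k)\<in>snd \<sigma>. \<theta> i * (1 + ?h (step \<phi> \<sigma> (Expiry i k))))"
      by (rule sum_pending[OF wf])
    also have "\<dots> \<le> (\<Sum>i\<in>UNIV. r $ i * (2 + ?h \<sigma>)) + (\<Sum>(i, k)\<in>snd \<sigma>. \<theta> i * ?h \<sigma>)"
    proof (rule add_mono)
      show "(\<Sum>i\<in>UNIV. r $ i * (1 + ?h (step \<phi> \<sigma> (Arrival i (fst \<sigma> i))))) \<le> (\<Sum>i\<in>UNIV. r $ i * (2 + ?h \<sigma>))"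
      proof (intro sum_mono mult_left_mono)
        show "1 + ?h (step \<phi> \<sigma> (Arrival i (fst \<sigma> i))) \<le> 2 + ?h \<sigma>" for i
          using arrival[of i] by simp
      qed (simp add: r_pos less_imp_le)
      have "(\<Sum>(i, k)\<in>snd \<sigma>. \<theta> i * (1 + ?h (step \<phi> \<sigma> (Expiry i k)))) = (\<Sum>(i, k)\<in>snd \<sigma>. \<theta> i * ?h \<sigma>)"
        by (rule sum.cong[OF refl]) (simp only: split_beta' expiry prod.collapse)
      then show "(\<Sum>(i, k)\<in>snd \<sigma>. \<theta> i * (1 + ?h (step \<phi> \<sigma> (Expiry i k)))) \<le> (\<Sum>(i, k)\<in>snd \<sigma>. \<theta> i * ?h \<sigma>)"
        by (rule eq_refl)
    qed
    also have "\<dots> = ?\<rho> + sum event_rate (pending \<sigma>) * ?h \<sigma>"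
    proof -
      have "(\<Sum>i\<in>UNIV. r $ i * (2 + ?h \<sigma>)) = ?\<rho> + (\<Sum>i\<in>UNIV. r $ i * ?h \<sigma>)"
        unfolding sum_distrib_left sum.distrib[symmetric] by (simp add: algebra_simps)
      then show ?thesis
        using sum_pending[OF wf, of "\<lambda>_. ?h \<sigma>"] by (simp add: sum_distrib_right)
    qed
    finally show "(\<Sum>e\<in>pending \<sigma>. event_rate e * (1 + ?h (step \<phi> \<sigma> e))) \<le>
        ?\<rho> + sum event_rate (pending \<sigma>) * ?h \<sigma>" .
  qed (simp_all add: finite_pending[OF wf] event_rate_pos \<rho> Suc.prems)
  finally show ?case .
qed (simp only: of_nat_0 mult_zero_left zero_le)

text \<open>The reward for runs cut off after \<open>n\<close> events adds at most
  \<open>\<rho> * T\<close> times the probability of \<open>n\<close> events by time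
  \<open>T\<close>, which is at most \<open>B / n\<close>. A large \<open>n\<close> pushes this
  below any \<open>\<epsilon>\<close>.\<close>

lemma expected_total_cost_ge:
  assumes nonneg: "\<And>\<sigma> e. 0 \<le> event_cost c1 c2 \<phi> \<sigma> e" "\<And>\<sigma>. h \<sigma> \<le> 0" "0 \<le> \<rho>"
    and drift: "\<And>\<sigma>. wf_config \<sigma> \<Longrightarrow> \<rho> + sum event_rate (pending \<sigma>) * h \<sigma> \<le>
      (\<Sum>e\<in>pending \<sigma>. event_rate e * (event_cost c1 c2 \<phi> \<sigma> e + h (step \<phi> \<sigma> e)))"
    and "0 \<le> T"
  shows "ennreal (h empty_config + \<rho> * T) \<le> (\<integral>\<^sup>+\<omega>. total_cost c1 c2 \<phi> T \<omega> \<partial>clock_space \<theta> r)"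
    (is "_ \<le> ?C")
proof (rule ennreal_le_epsilon)
  fix \<epsilon> :: real assume "0 < \<epsilon>"
  let ?V = "\<lambda>z n. expected_run \<phi> (\<lambda>\<sigma> e. ennreal (event_cost c1 c2 \<phi> \<sigma> e)) z n empty_config T"
  let ?P = "\<lambda>n. expected_run \<phi> (\<lambda>_ _. 0) 1 n empty_config T"
  define B where "B = 2 * (\<Sum>i\<in>UNIV. r $ i) * T"
  have "0 \<le> B" using r_pos \<open>0 \<le> T\<close> by (simp add: B_def sum_nonneg less_imp_le)
  obtain n :: nat where n: "\<rho> * T * B / \<epsilon> < n" "0 < n"
    using reals_Archimedean2[of "max 1 (\<rho> * T * B / \<epsilon>)"] that by (meson max_less_iff_conj less_trans zero_less_one of_nat_0_less_iff)
  have nP: "of_nat n * ?P n \<le> ennreal B"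
    using expected_run_nonexplosive[OF wf_empty_config \<open>0 \<le> T\<close>, of n \<phi>] by (simp add: B_def)
  have "ennreal (1 / n) * of_nat n = 1"
    using n(2) by (simp add: ennreal_of_nat_eq_real_of_nat ennreal_mult[symmetric])
  then have "?P n = ennreal (1 / n) * (of_nat n * ?P n)"
    by (simp add: mult.assoc[symmetric])
  also have "\<dots> \<le> ennreal (1 / n) * ennreal B"
    by (intro mult_left_mono nP) simp
  also have "\<dots> = ennreal (B / n)"
    using \<open>0 \<le> B\<close> by (simp add: ennreal_mult[symmetric])
  finally have "?P n \<le> ennreal (B / n)" .
  then have "ennreal (\<rho> * T) * ?P n \<le> ennreal (\<rho> * T) * ennreal (B / n)"
    by (rule mult_left_mono) simp
  also have "\<dots> = ennreal (\<rho> * T * B / n)"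
    using nonneg(3) \<open>0 \<le> T\<close> \<open>0 \<le> B\<close> by (simp add: ennreal_mult[symmetric])
  also have "\<dots> \<le> ennreal \<epsilon>"
    using n \<open>0 < \<epsilon>\<close> by (intro ennreal_leI) (simp add: field_simps)
  finally have P: "ennreal (\<rho> * T) * ?P n \<le> ennreal \<epsilon>" .
  have "ennreal (h empty_config + \<rho> * T) \<le> ?V (ennreal (\<rho> * T)) n"
    by (rule expected_run_ge[OF nonneg drift wf_empty_config \<open>0 \<le> T\<close> order_refl])
  also have "\<dots> = ?V 0 n + ennreal (\<rho> * T) * ?P n"
    by (rule expected_run_linear[OF wf_empty_config])
  also have "\<dots> \<le> ?C + ennreal \<epsilon>"
    unfolding expected_total_cost by (intro add_mono P SUP_upper) simp
  finally show "ennreal (h empty_config + \<rho> * T) \<le> ?C + ennreal \<epsilon>" .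
qed

end

section \<open>Prices and the linear program\<close>

text \<open>By counting: if the second entry were below \<open>b\<close>, only the first could reach
  \<open>b\<close>, yet \<open>a\<close> and \<open>b\<close> are two such elements. Multiset
  inclusion keeps the count right when \<open>a = b\<close>.\<close>

lemma le_nth_1_rev_sorted_list_of_multiset:
  fixes a b :: "'a::linorder"
  assumes "b \<le> a" "{#a, b#} \<subseteq># M"
  shows "b \<le> rev (sorted_list_of_multiset M) ! 1"
proof -
  define xs where "xs = rev (sorted_list_of_multiset M)"
  have M: "mset xs = M" and "sorted (rev xs)" by (simp_all add: xs_def)
  have "2 \<le> length xs"
    using size_mset_mono[OF assms(2)] by (simp flip: M)
  then obtain x y zs where xs: "xs = x # y # zs"
    by (cases xs; cases "tl xs") auto
  show ?thesis
  proof (rule ccontr)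
    assume "\<not> ?thesis"
    then have "y < b" by (simp add: xs_def[symmetric] xs)
    moreover have "z \<le> y" if "z \<in> set zs" for z
      using \<open>sorted (rev xs)\<close> that by (simp add: xs sorted_append)
    ultimately have no_zs: "filter_mset (\<lambda>z. b \<le> z) (mset zs) = {#}"
      by (force simp: filter_mset_eq_conv)
    have "size (filter_mset (\<lambda>z. b \<le> z) M) \<le> 1"
      using \<open>y < b\<close> by (auto simp: xs no_zs simp flip: M)
    moreover have "size (filter_mset (\<lambda>z. b \<le> z) {#a, b#}) \<le> size (filter_mset (\<lambda>z. b \<le> z) M)"
      by (intro size_mset_mono multiset_filter_mono assms(2))
    ultimately show False using assms(1) by simp
  qed
qed

text \<open>The diagonal efficiency is the largest in its row, so an off-diagonal one is at best
  second.\<close>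

lemma efficiency_le_critical_efficiency:
  fixes c1 :: "'n::finite \<Rightarrow> real"
  assumes pos: "\<And>i. 0 < c1 i" and diag: "\<And>i. c1 i = c2 i i"
    and c1_le: "\<And>i j. c1 i \<le> c2 i j" and sym: "\<And>i j. c2 i j = c2 j i" and "i \<noteq> j"
  shows "efficiency c1 c2 i j \<le> critical_efficiency c1 c2 2"
proof -
  have le: "efficiency c1 c2 i j \<le> efficiency c1 c2 i i"
    using pos[of i] pos[of j] c1_le[of i j] c1_le[of j i] sym[of i j]
    by (simp add: efficiency_def diag[symmetric] field_simps)
  have "{#i, j#} \<subseteq># mset_set UNIV"
    using \<open>i \<noteq> j\<close> mset_set.remove[of UNIV i] mset_set.remove[of "UNIV - {i}" j] by simp
  then have "{#efficiency c1 c2 i i, efficiency c1 c2 i j#} \<subseteq>#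
      image_mset (efficiency c1 c2 i) (mset_set UNIV)"
    using image_mset_subseteq_mono[of "{#i, j#}" "mset_set UNIV" "efficiency c1 c2 i"] by simp
  from le_nth_1_rev_sorted_list_of_multiset[OF le this]
  have "efficiency c1 c2 i j \<le> sorted_efficiency c1 c2 i 2"
    by (simp add: sorted_efficiency_def)
  also have "\<dots> \<le> Max (range (\<lambda>i. sorted_efficiency c1 c2 i 2))"
    by (intro Max_ge) auto
  also have "card {i, j} \<le> CARD('n)"
    by (intro card_mono) auto
  then have "Max (range (\<lambda>i. sorted_efficiency c1 c2 i 2)) = critical_efficiency c1 c2 2"
    using \<open>i \<noteq> j\<close> by (simp add: critical_efficiency_def)
  finally show ?thesis .
qed

text \<open>Once the value 1/2 is excluded, this makes the denominator in the rate condition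
  positive. With a single type the value is 0 by convention.\<close>

lemma critical_efficiency_le_half:
  fixes c1 :: "'n::finite \<Rightarrow> real"
  assumes pos: "\<And>i. 0 < c1 i" and c1_le: "\<And>i j. c1 i \<le> c2 i j" and sym: "\<And>i j. c2 i j = c2 j i"
  shows "critical_efficiency c1 c2 2 \<le> 1 / 2"
proof (cases "2 \<le> CARD('n)")
  case True
  have "efficiency c1 c2 i j \<le> 1 / 2" for i j
    using pos[of i] pos[of j] c1_le[of i j] c1_le[of j i] sym[of i j]
    by (simp add: efficiency_def field_simps)
  moreover have "sorted_efficiency c1 c2 i 2 \<in> range (efficiency c1 c2 i)" for i
  proof -
    let ?xs = "rev (sorted_list_of_multiset (image_mset (efficiency c1 c2 i) (mset_set UNIV)))"
    have "length ?xs = CARD('n)"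
      using size_mset[of ?xs] by simp
    then have "?xs ! 1 \<in> set ?xs"
      using True by (intro nth_mem) simp
    then show ?thesis by (simp add: sorted_efficiency_def)
  qed
  ultimately have "sorted_efficiency c1 c2 i 2 \<le> 1 / 2" for i
    by (metis rangeE)
  then have "Max (range (\<lambda>i. sorted_efficiency c1 c2 i 2)) \<le> 1 / 2"
    by (intro Max.boundedI) auto
  then show ?thesis
    using True by (simp add: critical_efficiency_def)
qed (simp add: critical_efficiency_def)

text \<open>The optimal dual variable of the flow balance constraint of type \<open>i\<close>, when only demands of
  equal type are matched. The dual variable of the constraint for \<open>x\<^sub>i\<^sub>i\<close> is
  \<open>c1 i / (2 * r $ i + \<theta> i)\<close>.\<close>

definition price :: "('n \<Rightarrow> real) \<Rightarrow> ('n \<Rightarrow> real) \<Rightarrow> real ^ 'n \<Rightarrow> 'n \<Rightarrow> real" where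
  "price c1 \<theta> r i = c1 i * (r $ i + \<theta> i) / (2 * r $ i + \<theta> i)"

definition self_matching_cost :: "('n::finite \<Rightarrow> real) \<Rightarrow> ('n \<Rightarrow> real) \<Rightarrow> real ^ 'n \<Rightarrow> real" where
  "self_matching_cost c1 \<theta> r = (\<Sum>i\<in>UNIV. price c1 \<theta> r i * r $ i)"

text \<open>With \<open>e\<close> the second critical efficiency, the rate condition is, up to
  strictness, \<open>price c1 \<theta> r i \<le> (1 - e) * c1 i\<close>; and \<open>c2 i j\<close>
  is \<open>c1 i + c1 j\<close> times 1 minus the efficiency of the pair.\<close>

lemma price_add_le:
  fixes c1 :: "'n::finite \<Rightarrow> real"
  assumes pos: "\<And>i. 0 < c1 i" and diag: "\<And>i. c1 i = c2 i i"
    and c1_le: "\<And>i j. c1 i \<le> c2 i j" and sym: "\<And>i j. c2 i j = c2 j i"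
    and \<theta>: "\<And>i. 0 < \<theta> i" and r: "\<And>i. 0 < r $ i"
    and neq: "critical_efficiency c1 c2 2 \<noteq> 1 / 2"
    and rate: "\<And>i. \<theta> i * (critical_efficiency c1 c2 2 / (1 - 2 * critical_efficiency c1 c2 2)) < r $ i"
    and "i \<noteq> j"
  shows "price c1 \<theta> r i + price c1 \<theta> r j \<le> c2 i j"
proof -
  define e where "e = critical_efficiency c1 c2 2"
  have e: "e < 1 / 2"
    using critical_efficiency_le_half[of c1 c2, OF pos c1_le sym] neq by (simp add: e_def)
  have price: "price c1 \<theta> r i \<le> (1 - e) * c1 i" for i
  proof -
    have "\<theta> i * e < r $ i * (1 - 2 * e)"
      using rate[of i] e by (simp add: e_def[symmetric] field_simps)
    then have "r $ i + \<theta> i \<le> (1 - e) * (2 * r $ i + \<theta> i)"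
      by (simp add: algebra_simps)
    then have "c1 i * (r $ i + \<theta> i) \<le> c1 i * ((1 - e) * (2 * r $ i + \<theta> i))"
      using pos[of i] by (intro mult_left_mono) auto
    then show ?thesis
      using r[of i] \<theta>[of i] by (simp add: price_def pos_divide_le_eq mult_ac)
  qed
  have "price c1 \<theta> r i + price c1 \<theta> r j \<le> (1 - e) * (c1 i + c1 j)"
    using price[of i] price[of j] by (simp add: distrib_left)
  also have "\<dots> \<le> (1 - efficiency c1 c2 i j) * (c1 i + c1 j)"
    using efficiency_le_critical_efficiency[of c1 c2, OF pos diag c1_le sym \<open>i \<noteq> j\<close>] pos[of i] pos[of j]
    by (intro mult_right_mono) (auto simp: e_def)
  also have "\<dots> = c2 i j"
    using pos[of i] pos[of j] by (simp add: efficiency_def)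
  finally show ?thesis .
qed

section \<open>Linear programming duality\<close>

context matching_rates
begin

lemma denominator_pos: "0 < 2 * r $ i + \<theta> i"
  using r_pos[of i] \<theta>_pos[of i] by simp

text \<open>With \<open>u\<close> the price and \<open>v = c1 i / (2 * r $ i + \<theta> i)\<close>,
  this identity and the next say that the dual constraints of \<open>y i\<close> and
  \<open>x i i\<close> are tight: \<open>u + r $ i * v = c1 i\<close> and
  \<open>2 * u - \<theta> i * v = c1 i\<close>. Solving them gives the formula for the
  price.\<close>

lemma price_complement: "c1 i - price c1 \<theta> r i = r $ i * (c1 i / (2 * r $ i + \<theta> i))"
  using denominator_pos[of i] by (simp add: price_def field_simps)

lemma price_double: "c1 i - 2 * price c1 \<theta> r i = - \<theta> i * (c1 i / (2 * r $ i + \<theta> i))"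
  using denominator_pos[of i] by (simp add: price_def field_simps)

text \<open>Weak duality: only \<open>x i i\<close> has a negative reduced cost, and the constraint
  \<open>\<theta> i * x i i \<le> r $ i * y i\<close> lets the reduced cost of \<open>y i\<close>
  pay for it.\<close>

lemma self_matching_cost_le_lp_objective:
  assumes pos: "\<And>i. 0 < c1 i" and diag: "\<And>i. c1 i = c2 i i"
    and cross: "\<And>i j. i \<noteq> j \<Longrightarrow> price c1 \<theta> r i + price c1 \<theta> r j \<le> c2 i j"
    and feasible: "lp_feasible \<theta> r x y"
  shows "self_matching_cost c1 \<theta> r \<le> lp_objective c1 c2 x y"
proof -
  let ?u = "price c1 \<theta> r" and ?v = "\<lambda>i. c1 i / (2 * r $ i + \<theta> i)"
  let ?D = "\<lambda>i j. c2 i j - ?u i - ?u j"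
  have x: "0 \<le> x i j" and xy: "\<theta> i * x i j \<le> r $ j * y i"
    and balance: "r $ i = (\<Sum>j\<in>UNIV. x j i) + (\<Sum>j\<in>UNIV. x i j) + y i" for i j
    using feasible by (auto simp: lp_feasible_def)
  have "self_matching_cost c1 \<theta> r =
      (\<Sum>i\<in>UNIV. \<Sum>j\<in>UNIV. ?u i * x j i) + (\<Sum>i\<in>UNIV. \<Sum>j\<in>UNIV. ?u i * x i j) + (\<Sum>i\<in>UNIV. ?u i * y i)"
    unfolding self_matching_cost_def
    by (subst balance) (simp add: distrib_left sum.distrib sum_distrib_left)
  also have "(\<Sum>i\<in>UNIV. \<Sum>j\<in>UNIV. ?u i * x j i) = (\<Sum>i\<in>UNIV. \<Sum>j\<in>UNIV. ?u j * x i j)"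
    by (rule sum.swap)
  finally have "lp_objective c1 c2 x y - self_matching_cost c1 \<theta> r =
      (\<Sum>i\<in>UNIV. (\<Sum>j\<in>UNIV. ?D i j * x i j) + (c1 i - ?u i) * y i)"
    by (simp add: lp_objective_def left_diff_distrib sum.distrib sum_subtractf)
  also have "\<dots> \<ge> 0"
  proof (rule sum_nonneg)
    fix i
    have "?D i i * x i i \<le> (\<Sum>j\<in>UNIV. ?D i j * x i j)"
    proof (rule member_le_sum)
      fix j assume "j \<in> UNIV - {i}"
      then show "0 \<le> ?D i j * x i j"
        using cross[of i j] x[of i j] by (intro mult_nonneg_nonneg) auto
    qed auto
    moreover have "?D i i * x i i + (c1 i - ?u i) * y i = ?v i * (r $ i * y i - \<theta> i * x i i)"
    proof -
      define v where "v = ?v i"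
      have "?D i i = - \<theta> i * v" "c1 i - ?u i = r $ i * v"
        using price_double[of c1 i] price_complement[of c1 i] diag[of i] by (simp_all add: v_def)
      then show ?thesis
        unfolding v_def[symmetric] by (simp only: right_diff_distrib mult_ac mult_minus_left)
    qed
    moreover have "0 \<le> ?v i * (r $ i * y i - \<theta> i * x i i)"
      using xy[of i i] pos[of i] denominator_pos[of i] by (intro mult_nonneg_nonneg) auto
    ultimately show "0 \<le> (\<Sum>j\<in>UNIV. ?D i j * x i j) + (c1 i - ?u i) * y i"
      by linarith
  qed
  finally show ?thesis by simp
qed

lemma lp_value_eq:
  assumes pos: "\<And>i. 0 < c1 i" and diag: "\<And>i. c1 i = c2 i i"
    and cross: "\<And>i j. i \<noteq> j \<Longrightarrow> price c1 \<theta> r i + price c1 \<theta> r j \<le> c2 i j"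
  shows "lp_value c1 c2 \<theta> r = self_matching_cost c1 \<theta> r"
  unfolding lp_value_def
proof (rule cInf_eq_minimum)
  \<comment> \<open>Without matches between types, the balance
    \<open>2 * x i i + y i = r $ i\<close> and the tight constraint
    \<open>\<theta> i * x i i = r $ i * y i\<close> determine this point.\<close>
  define x where "x i j = (if i = j then (r $ i)\<^sup>2 / (2 * r $ i + \<theta> i) else 0)" for i j
  define y where "y i = \<theta> i * r $ i / (2 * r $ i + \<theta> i)" for i
  have "lp_feasible \<theta> r x y"
    unfolding lp_feasible_def
  proof (intro conjI allI)
    fix i j
    have [simp]: "r $ i * 2 + \<theta> i \<noteq> 0" "2 * r $ i + \<theta> i \<noteq> 0" using denominator_pos[of i] by auto
    have "(r $ i)\<^sup>2 / (2 * r $ i + \<theta> i) + (r $ i)\<^sup>2 / (2 * r $ i + \<theta> i) + \<theta> i * r $ i / (2 * r $ i + \<theta> i) =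
        r $ i * (2 * r $ i + \<theta> i) / (2 * r $ i + \<theta> i)"
      unfolding add_divide_distrib[symmetric] by (simp add: power2_eq_square algebra_simps)
    then show "(\<Sum>j\<in>UNIV. x j i) + (\<Sum>j\<in>UNIV. x i j) + y i = r $ i"
      by (simp add: x_def y_def)
    show "0 \<le> x i j" "0 \<le> y i"
      using r_pos[of i] \<theta>_pos[of i] denominator_pos[of i]
      by (auto simp: x_def y_def less_imp_le intro!: divide_nonneg_pos)
    then have "0 \<le> r $ j * y i"
      using r_pos[of j] by simp
    then show "\<theta> i * x i j \<le> r $ j * y i"
      by (cases "i = j") (simp_all add: x_def y_def power2_eq_square mult_ac)
  qed
  moreover have "lp_objective c1 c2 x y = self_matching_cost c1 \<theta> r"
  proof -
    have "(\<Sum>j\<in>UNIV. c2 i j * x i j) = c1 i * ((r $ i)\<^sup>2 / (2 * r $ i + \<theta> i))" for i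
      by (simp add: x_def diag if_distrib cong: if_cong)
    then show ?thesis
      by (simp add: lp_objective_def self_matching_cost_def sum.distrib[symmetric] y_def price_def
          power2_eq_square add_divide_distrib[symmetric] algebra_simps)
  qed
  ultimately show "self_matching_cost c1 \<theta> r \<in> {lp_objective c1 c2 x y |x y. lp_feasible \<theta> r x y}"
    by (metis (mono_tags, lifting) mem_Collect_eq)
qed (use self_matching_cost_le_lp_objective[of c1 c2] assms in auto)

end

section \<open>Concavity of the self-matching cost\<close>

lemma concave_self_matching_rate:
  fixes a b u v t :: real
  assumes "0 < a" "0 < b" "0 \<le> u" "0 \<le> v" "u + v = 1" "0 < t"
  shows "u * ((a + t) / (2 * a + t) * a) + v * ((b + t) / (2 * b + t) * b) \<le>
    (u * a + v * b + t) / (2 * (u * a + v * b) + t) * (u * a + v * b)"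
proof -
  \<comment> \<open>An affine function minus a multiple of a reciprocal, so concavity reduces to
    convexity of the inverse on the positive reals.\<close>
  have eq: "(s + t) / (2 * s + t) * s = (2 * s + t) / 4 - t\<^sup>2 / 4 * inverse (2 * s + t)" if "0 < s" for s
  proof -
    have "2 * s + t \<noteq> 0" using that assms by auto
    then show ?thesis by (simp add: field_simps power2_eq_square)
  qed
  have "0 < u * a + v * b"
    using assms by (cases "u = 0") (auto intro: add_pos_nonneg)
  have "inverse (u * (2 * a + t) + v * (2 * b + t)) \<le> u * inverse (2 * a + t) + v * inverse (2 * b + t)"
  proof -
    have "1 - v = u" "v \<le> 1" using assms by auto
    then show ?thesis
      using convex_onD[OF convex_on_inverse[of "{0<..}"], of v "2 * a + t" "2 * b + t"] assms(1-4,6)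
      by simp
  qed
  moreover have sum: "u * (2 * a + t) + v * (2 * b + t) = 2 * (u * a + v * b) + t"
  proof -
    have "u * t + v * t = t" using assms(5) by (metis distrib_right mult_1)
    then show ?thesis by (simp add: algebra_simps)
  qed
  ultimately have "t\<^sup>2 / 4 * inverse (2 * (u * a + v * b) + t) \<le>
      t\<^sup>2 / 4 * (u * inverse (2 * a + t) + v * inverse (2 * b + t))"
    by (intro mult_left_mono) auto
  moreover have "u * ((a + t) / (2 * a + t) * a) + v * ((b + t) / (2 * b + t) * b) =
      (u * (2 * a + t) + v * (2 * b + t)) / 4 -
      t\<^sup>2 / 4 * (u * inverse (2 * a + t) + v * inverse (2 * b + t))"
    unfolding eq[OF \<open>0 < a\<close>] eq[OF \<open>0 < b\<close>] by (simp add: algebra_simps add_divide_distrib)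
  ultimately show ?thesis
    unfolding eq[OF \<open>0 < u * a + v * b\<close>] sum by linarith
qed

lemma concave_on_self_matching_cost:
  fixes c1 :: "'n::finite \<Rightarrow> real"
  assumes pos: "\<And>i. 0 < c1 i" and \<theta>: "\<And>i. 0 < \<theta> i" and lo: "\<And>i. 0 < lo $ i"
  shows "concave_on (cbox lo hi) (self_matching_cost c1 \<theta>)"
  unfolding concave_on_iff
proof (intro conjI ballI allI impI)
  fix x y :: "real ^ 'n" and u v :: real
  assume x: "x \<in> cbox lo hi" and y: "y \<in> cbox lo hi" and uv: "0 \<le> u" "0 \<le> v" "u + v = 1"
  have "0 < x $ i" "0 < y $ i" for i
    using x y lo[of i] by (auto simp: mem_box_cart intro: less_le_trans)
  then have "c1 i * (u * ((x $ i + \<theta> i) / (2 * x $ i + \<theta> i) * x $ i) + v * ((y $ i + \<theta> i) / (2 * y $ i + \<theta> i) * y $ i)) \<le>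
      c1 i * ((u * x $ i + v * y $ i + \<theta> i) / (2 * (u * x $ i + v * y $ i) + \<theta> i) * (u * x $ i + v * y $ i))" for i
    using pos[of i] \<theta>[of i] uv by (intro mult_left_mono concave_self_matching_rate) (auto simp: less_imp_le)
  then show "u * self_matching_cost c1 \<theta> x + v * self_matching_cost c1 \<theta> y \<le>
      self_matching_cost c1 \<theta> (u *\<^sub>R x + v *\<^sub>R y)"
    unfolding self_matching_cost_def price_def sum_distrib_left sum.distrib[symmetric]
    by (intro sum_mono) (simp add: algebra_simps)
qed simp

section \<open>The matching process\<close>

lemma finite_section: "finite W \<Longrightarrow> finite {k. (i, k) \<in> W}"
  by (rule finite_subset[of _ "snd ` W"]) force+

lemma queue_state_insert:
  assumes "finite W" "(i, k) \<notin> W"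
  shows "queue_state (insert (i, k) W) = (queue_state W)(i := Suc (queue_state W i))"
proof
  fix j
  have "{l. (i, l) \<in> insert (i, k) W} = insert k {l. (i, l) \<in> W}" by auto
  then show "queue_state (insert (i, k) W) j = ((queue_state W)(i := Suc (queue_state W i))) j"
    using assms by (auto simp: queue_state_def finite_section)
qed

lemma queue_state_remove:
  assumes "finite W" "(i, k) \<in> W"
  shows "queue_state (W - {(i, k)}) = (queue_state W)(i := queue_state W i - 1)"
proof
  fix j
  have "{l. (i, l) \<in> W - {(i, k)}} = {l. (i, l) \<in> W} - {k}" by auto
  then show "queue_state (W - {(i, k)}) j = ((queue_state W)(i := queue_state W i - 1)) j"
    using assms by (auto simp: queue_state_def finite_section)
qed

lemma queue_state_pos_iff: "finite W \<Longrightarrow> 0 < queue_state W i \<longleftrightarrow> (\<exists>k. (i, k) \<in> W)"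
  by (auto simp: queue_state_def card_gt_0_iff finite_section)

text \<open>Admissibility guarantees a waiting demand of the chosen type, so \<open>LEAST\<close>
  picks an element of the queue and its removal is a genuine decrement.\<close>

lemma queue_state_step_Arrival:
  assumes "wf_config \<sigma>" "admissible \<phi>"
  shows "queue_state (snd (step \<phi> \<sigma> (Arrival i (fst \<sigma> i)))) =
    (case \<phi> i (queue_state (snd \<sigma>)) of
       None \<Rightarrow> (queue_state (snd \<sigma>))(i := Suc (queue_state (snd \<sigma>) i))
     | Some j \<Rightarrow> (queue_state (snd \<sigma>))(j := queue_state (snd \<sigma>) j - 1))"
proof -
  have fin: "finite (snd \<sigma>)" using assms(1) by (simp add: wf_config_def)
  have "(i, fst \<sigma> i) \<notin> snd \<sigma>"
    using wf_configD[OF assms(1)] by blast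
  moreover have "(j, LEAST l. (j, l) \<in> snd \<sigma>) \<in> snd \<sigma>" if "\<phi> i (queue_state (snd \<sigma>)) = Some j" for j
    using assms(2) that queue_state_pos_iff[OF fin, of j] by (auto simp: admissible_def intro: LeastI)
  ultimately show ?thesis
    using fin by (cases \<sigma>) (auto simp: queue_state_insert queue_state_remove split: option.split)
qed

lemma queue_state_step_Expiry:
  assumes "wf_config \<sigma>" "(i, k) \<in> snd \<sigma>"
  shows "queue_state (snd (step \<phi> \<sigma> (Expiry i k))) =
    (queue_state (snd \<sigma>))(i := queue_state (snd \<sigma>) i - 1)"
  using assms by (cases \<sigma>) (simp add: wf_config_def queue_state_remove)

lemma sum_over_waiting:
  fixes F :: "'n::finite \<Rightarrow> real"
  assumes "finite W"
  shows "(\<Sum>(i, k)\<in>W. F i) = (\<Sum>i\<in>UNIV. real (queue_state W i) * F i)"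
proof -
  have W: "W = Sigma UNIV (\<lambda>i. {k. (i, k) \<in> W})" by auto
  have "(\<Sum>(i, k)\<in>W. F i) = (\<Sum>i\<in>UNIV. \<Sum>k\<in>{k. (i, k) \<in> W}. F i)"
    by (subst W, rule sum.Sigma[symmetric]) (auto simp: assms finite_section)
  then show ?thesis by (simp add: queue_state_def)
qed

text \<open>Each event changes a single queue, so a separable form reduces every change of the
  potential to one increment of one \<open>g i\<close>.\<close>

definition potential :: "('n::finite \<Rightarrow> nat \<Rightarrow> real) \<Rightarrow> ('n \<Rightarrow> nat) \<Rightarrow> real" where
  "potential g s = (\<Sum>i\<in>UNIV. g i (s i))"

lemma potential_fun_upd: "potential g (s(i := x)) - potential g s = g i x - g i (s i)"
proof -
  have "(\<Sum>j\<in>UNIV - {i}. g j ((s(i := x)) j)) = (\<Sum>j\<in>UNIV - {i}. g j (s j))"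
    by (intro sum.cong) auto
  then show ?thesis by (simp add: potential_def sum.remove[of UNIV i])
qed

definition greedy :: "'n policy" where
  "greedy i s = (if 0 < s i then Some i else None)"

lemma admissible_greedy: "admissible greedy"
  by (simp add: admissible_def greedy_def)

section \<open>Average costs of the greedy policy and of arbitrary policies\<close>

context matching_rates
begin

text \<open>The sum over types on the right is the cost rate plus the generator applied to the
  potential. Grouping it by type lets both drift conditions be checked type by type.\<close>

lemma generator_potential:
  assumes wf: "wf_config \<sigma>" and "admissible \<phi>"
  defines "s \<equiv> queue_state (snd \<sigma>)"
  shows "(\<Sum>e\<in>pending \<sigma>. event_rate e *
      (event_cost c1 c2 \<phi> \<sigma> e + potential g (queue_state (snd (step \<phi> \<sigma> e))))) =
    sum event_rate (pending \<sigma>) * potential g s +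
    (\<Sum>i\<in>UNIV. r $ i * (case \<phi> i s of None \<Rightarrow> g i (Suc (s i)) - g i (s i)
         | Some j \<Rightarrow> c2 i j + g j (s j - 1) - g j (s j)) +
       real (s i) * (\<theta> i * (c1 i + g i (s i - 1) - g i (s i))))"
proof -
  let ?G = "\<lambda>e. event_cost c1 c2 \<phi> \<sigma> e + (potential g (queue_state (snd (step \<phi> \<sigma> e))) - potential g s)"
  have "(\<Sum>e\<in>pending \<sigma>. event_rate e *
      (event_cost c1 c2 \<phi> \<sigma> e + potential g (queue_state (snd (step \<phi> \<sigma> e))))) =
    sum event_rate (pending \<sigma>) * potential g s + (\<Sum>e\<in>pending \<sigma>. event_rate e * ?G e)"
    unfolding sum_distrib_right sum.distrib[symmetric]
    by (intro sum.cong refl) (simp add: algebra_simps)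
  also have "(\<Sum>e\<in>pending \<sigma>. event_rate e * ?G e) =
    (\<Sum>i\<in>UNIV. r $ i * ?G (Arrival i (fst \<sigma> i))) + (\<Sum>(i, k)\<in>snd \<sigma>. \<theta> i * ?G (Expiry i k))"
    by (rule sum_pending[OF wf])
  also have "(\<Sum>(i, k)\<in>snd \<sigma>. \<theta> i * ?G (Expiry i k)) =
      (\<Sum>(i, k)\<in>snd \<sigma>. \<theta> i * (c1 i + g i (s i - 1) - g i (s i)))"
  proof (rule sum.cong[OF refl], clarify)
    fix i k assume ik: "(i, k) \<in> snd \<sigma>"
    have "event_cost c1 c2 \<phi> \<sigma> (Expiry i k) = c1 i" by (cases \<sigma>) simp
    then show "\<theta> i * ?G (Expiry i k) = \<theta> i * (c1 i + g i (s i - 1) - g i (s i))"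
      unfolding queue_state_step_Expiry[OF wf ik] s_def potential_fun_upd by simp
  qed
  also have "\<dots> = (\<Sum>i\<in>UNIV. real (s i) * (\<theta> i * (c1 i + g i (s i - 1) - g i (s i))))"
    unfolding s_def by (rule sum_over_waiting) (use wf in \<open>simp add: wf_config_def\<close>)
  also have "(\<Sum>i\<in>UNIV. r $ i * ?G (Arrival i (fst \<sigma> i))) =
      (\<Sum>i\<in>UNIV. r $ i * (case \<phi> i s of None \<Rightarrow> g i (Suc (s i)) - g i (s i)
         | Some j \<Rightarrow> c2 i j + g j (s j - 1) - g j (s j)))"
  proof (rule sum.cong[OF refl])
    fix i
    have "event_cost c1 c2 \<phi> \<sigma> (Arrival i (fst \<sigma> i)) = (case \<phi> i s of None \<Rightarrow> 0 | Some j \<Rightarrow> c2 i j)"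
      by (cases \<sigma>) (simp add: s_def)
    then show "r $ i * ?G (Arrival i (fst \<sigma> i)) =
        r $ i * (case \<phi> i s of None \<Rightarrow> g i (Suc (s i)) - g i (s i)
         | Some j \<Rightarrow> c2 i j + g j (s j - 1) - g j (s j))"
      unfolding queue_state_step_Arrival[OF wf assms(2)]
      by (simp add: s_def[symmetric] potential_fun_upd split: option.split)
  qed
  finally show ?thesis by (simp add: sum.distrib)
qed

lemma self_matching_cost_pos:
  assumes "\<And>i. 0 < c1 i"
  shows "0 < self_matching_cost c1 \<theta> r"
  unfolding self_matching_cost_def price_def
  using assms r_pos \<theta>_pos denominator_pos
  by (intro sum_pos mult_pos_pos divide_pos_pos) (auto intro: add_pos_pos)

text \<open>Started empty, the greedy policy never holds two demands of one type. With
  \<open>u\<close> the price, the drift of type \<open>i\<close> is \<open>r $ i * u\<close> for an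
  empty queue and \<open>(r $ i + \<theta> i) * (c1 i - u)\<close> for one waiting demand; the price
  is the value at which the two agree.\<close>

lemma average_cost_greedy_le:
  assumes pos: "\<And>i. 0 < c1 i" and diag: "\<And>i. c1 i = c2 i i" and c2: "\<And>i j. 0 < c2 i j"
  shows "average_cost c1 c2 \<theta> r greedy \<le> ennreal (self_matching_cost c1 \<theta> r)"
proof -
  let ?u = "price c1 \<theta> r" and ?\<rho> = "self_matching_cost c1 \<theta> r"
  let ?g = "\<lambda>i k. ?u i * real k"
  define I where "I \<sigma> \<longleftrightarrow> wf_config \<sigma> \<and> (\<forall>i. queue_state (snd \<sigma>) i \<le> 1)" for \<sigma> :: "'n config"
  have u_nonneg: "0 \<le> ?u i" for i
    using pos[of i] r_pos[of i] \<theta>_pos[of i] denominator_pos[of i] by (simp add: price_def)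
  have bound: "expected_run greedy (\<lambda>\<sigma> e. ennreal (event_cost c1 c2 greedy \<sigma> e)) 0 n empty_config T \<le>
      ennreal (potential ?g (queue_state (snd (empty_config :: 'n config))) + ?\<rho> * T)"
    if "0 \<le> T" for n T
  proof (rule expected_run_le[where I = I and h = "\<lambda>\<sigma>. potential ?g (queue_state (snd \<sigma>))", OF _ _ _ _ _ _ _ that])
    fix \<sigma> :: "'n config" and e assume \<sigma>: "I \<sigma>" "e \<in> pending \<sigma>"
    then have wf: "wf_config \<sigma>" and s: "queue_state (snd \<sigma>) i \<le> 1" for i by (auto simp: I_def)
    have "queue_state (snd (step greedy \<sigma> e)) i \<le> 1" for i
    proof (cases e)
      case (Arrival j k)
      then show ?thesis
        using \<sigma>(2) s[of i] queue_state_step_Arrival[OF wf admissible_greedy, of j]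
        by (auto simp: greedy_def)
    next
      case (Expiry j k)
      then show ?thesis
        using \<sigma>(2) s[of i] s[of j] queue_state_step_Expiry[OF wf, of j k greedy] by auto
    qed
    then show "I (step greedy \<sigma> e)"
      using wf_config_step[OF wf \<sigma>(2)] by (simp add: I_def)
  next
    fix \<sigma> :: "'n config" assume "I \<sigma>"
    then have wf: "wf_config \<sigma>" and s: "queue_state (snd \<sigma>) i \<le> 1" for i by (auto simp: I_def)
    let ?s = "queue_state (snd \<sigma>)"
    have "r $ i * (case greedy i ?s of None \<Rightarrow> ?g i (Suc (?s i)) - ?g i (?s i)
         | Some j \<Rightarrow> c2 i j + ?g j (?s j - 1) - ?g j (?s j)) +
       real (?s i) * (\<theta> i * (c1 i + ?g i (?s i - 1) - ?g i (?s i))) = ?u i * r $ i" for i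
    proof (cases "?s i")
      case 0
      then show ?thesis by (simp add: greedy_def algebra_simps)
    next
      case (Suc m)
      then have "?s i = 1" using s[of i] by simp
      moreover have "(r $ i + \<theta> i) * (c1 i - ?u i) = ?u i * r $ i"
        using price_complement[of c1 i] by (simp add: price_def)
      ultimately show ?thesis by (simp add: greedy_def diag algebra_simps)
    qed
    then show "(\<Sum>e\<in>pending \<sigma>. event_rate e *
        (event_cost c1 c2 greedy \<sigma> e + potential ?g (queue_state (snd (step greedy \<sigma> e))))) \<le>
      ?\<rho> + sum event_rate (pending \<sigma>) * potential ?g (queue_state (snd \<sigma>))"
      unfolding generator_potential[OF wf admissible_greedy] by (simp add: self_matching_cost_def)
  next
    fix \<sigma> :: "'n config" and e
    show "0 \<le> event_cost c1 c2 greedy \<sigma> e"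
      using pos c2 by (cases \<sigma>; cases e) (auto simp: less_imp_le split: option.split)
    show "0 \<le> potential ?g (queue_state (snd \<sigma>))"
      unfolding potential_def using u_nonneg by (intro sum_nonneg) simp
  qed (auto simp: I_def wf_empty_config queue_state_def self_matching_cost_pos[OF pos] less_imp_le)
  have "potential ?g (queue_state (snd (empty_config :: 'n config))) = 0"
    by (simp add: potential_def queue_state_def)
  with bound have "(\<integral>\<^sup>+\<omega>. total_cost c1 c2 greedy T \<omega> \<partial>clock_space \<theta> r) \<le> ennreal (?\<rho> * T)"
    if "0 \<le> T" for T
    unfolding expected_total_cost using that by (intro SUP_least) simp
  then have "(\<integral>\<^sup>+\<omega>. total_cost c1 c2 greedy T \<omega> \<partial>clock_space \<theta> r) / ennreal T \<le> ennreal ?\<rho>"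
    if "0 < T" for T
    using divide_right_mono_ennreal[of _ "ennreal (?\<rho> * T)" "ennreal T"] that self_matching_cost_pos[of c1] pos
    by (simp add: divide_ennreal less_imp_le)
  then show ?thesis
    unfolding average_cost_def
    by (intro Limsup_bounded eventually_mono[OF eventually_gt_at_top[of 0]])
qed

text \<open>The quadratic part of the potential keeps it bounded above, whatever the policy; it is
  scaled by \<open>\<epsilon>\<close> so that its effect on the drift is small.\<close>

lemma expected_total_cost_lower_bound:
  assumes pos: "\<And>i. 0 < c1 i" and diag: "\<And>i. c1 i = c2 i i" and c2: "\<And>i j. 0 < c2 i j"
    and cross: "\<And>i j. i \<noteq> j \<Longrightarrow> price c1 \<theta> r i + price c1 \<theta> r j \<le> c2 i j"
    and adm: "admissible \<phi>" and "0 < \<epsilon>" "0 \<le> T"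
    and small: "\<epsilon> * (\<Sum>i\<in>UNIV. (r $ i)\<^sup>2 / \<theta> i + r $ i) \<le> self_matching_cost c1 \<theta> r"
  shows "ennreal ((self_matching_cost c1 \<theta> r - \<epsilon> * (\<Sum>i\<in>UNIV. (r $ i)\<^sup>2 / \<theta> i + r $ i)) * T -
      (\<Sum>i\<in>UNIV. (price c1 \<theta> r i)\<^sup>2 / (4 * \<epsilon>))) \<le>
    (\<integral>\<^sup>+\<omega>. total_cost c1 c2 \<phi> T \<omega> \<partial>clock_space \<theta> r)"
proof -
  let ?u = "price c1 \<theta> r" and ?v = "\<lambda>i. c1 i / (2 * r $ i + \<theta> i)"
  let ?\<rho> = "self_matching_cost c1 \<theta> r - \<epsilon> * (\<Sum>i\<in>UNIV. (r $ i)\<^sup>2 / \<theta> i + r $ i)"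
  \<comment> \<open>\<open>u\<^sup>2 / (4 * \<epsilon>)\<close> is the maximum of the parabola
    \<open>u * k - \<epsilon> * k\<^sup>2\<close> over real \<open>k\<close>, so subtracting
    \<open>K\<close> makes the potential nonpositive.\<close>
  define K where "K = (\<Sum>i\<in>UNIV. (?u i)\<^sup>2 / (4 * \<epsilon>))"
  define g where "g i k = ?u i * real k - \<epsilon> * (real k)\<^sup>2" for i k
  have cost_nonneg: "0 \<le> event_cost c1 c2 \<phi> \<sigma> e" for \<sigma> e
    using pos c2 by (cases \<sigma>; cases e) (auto simp: less_imp_le split: option.split)
  have g_le: "g i k \<le> (?u i)\<^sup>2 / (4 * \<epsilon>)" for i k
  proof -
    have "0 \<le> (?u i - 2 * \<epsilon> * real k)\<^sup>2" by simp
    then show ?thesis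
      using \<open>0 < \<epsilon>\<close> by (simp add: g_def field_simps power2_eq_square)
  qed
  have "ennreal (potential g (queue_state (snd (empty_config :: 'n config))) - K + ?\<rho> * T) \<le>
      (\<integral>\<^sup>+\<omega>. total_cost c1 c2 \<phi> T \<omega> \<partial>clock_space \<theta> r)"
  proof (rule expected_total_cost_ge[where h = "\<lambda>\<sigma>. potential g (queue_state (snd \<sigma>)) - K", OF cost_nonneg _ _ _ \<open>0 \<le> T\<close>])
    show "potential g (queue_state (snd \<sigma>)) - K \<le> 0" for \<sigma> :: "'n config"
      by (simp add: potential_def K_def g_le sum_mono)
    show "0 \<le> ?\<rho>" using small by simp
  next
    fix \<sigma> :: "'n config" assume wf: "wf_config \<sigma>"
    define s where "s = queue_state (snd \<sigma>)"
    define D where "D i = r $ i * (case \<phi> i s of None \<Rightarrow> g i (Suc (s i)) - g i (s i)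
         | Some j \<Rightarrow> c2 i j + g j (s j - 1) - g j (s j)) +
       real (s i) * (\<theta> i * (c1 i + g i (s i - 1) - g i (s i)))" for i
    have "?u i * r $ i - \<epsilon> * ((r $ i)\<^sup>2 / \<theta> i + r $ i) \<le> D i" for i
    proof -
      let ?x = "real (s i)"
      define v where "v = ?v i"
      have v: "0 \<le> v" using pos[of i] denominator_pos[of i] by (simp add: v_def)
      have c1_eq: "c1 i - ?u i = r $ i * v" "c1 i - ?u i = ?u i - \<theta> i * v"
        using price_complement[of c1 i] price_double[of c1 i] by (simp_all add: v_def)
      have dec: "g j (s j - 1) - g j (s j) = - ?u j + \<epsilon> * (2 * real (s j) - 1)" if "0 < s j" for j
        using that by (simp add: g_def of_nat_diff power2_eq_square algebra_simps)
      have expiry: "?x * (\<theta> i * (r $ i * v + \<epsilon> * (2 * ?x - 1))) = 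
          ?x * (\<theta> i * (c1 i + g i (s i - 1) - g i (s i)))"
      proof (cases "s i")
        case (Suc m)
        then have "r $ i * v + \<epsilon> * (2 * ?x - 1) = c1 i + g i (s i - 1) - g i (s i)"
          using dec[of i] c1_eq(1) by linarith
        then show ?thesis by simp
      qed simp
      \<comment> \<open>Apart from terms in \<open>\<epsilon>\<close>, expiries contribute
        \<open>\<theta> i * r $ i * v\<close> per waiting demand. Spread over arrivals at rate
        \<open>r $ i\<close>, this is a credit of \<open>\<theta> i * v * ?x\<close> each, so an
        arrival need only account for the price minus that credit.\<close>
      have arrival: "?u i - \<theta> i * v * ?x - \<epsilon> * (2 * ?x + 1) \<le>
          (case \<phi> i s of None \<Rightarrow> g i (Suc (s i)) - g i (s i)
         | Some j \<Rightarrow> c2 i j + g j (s j - 1) - g j (s j))"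
      proof (cases "\<phi> i s")
        case None
        have "0 \<le> \<theta> i * v * ?x" using v \<theta>_pos[of i] by simp
        then show ?thesis
          using None by (simp add: g_def power2_eq_square algebra_simps)
      next
        case (Some j)
        then have sj: "0 < s j" using adm by (auto simp: admissible_def)
        have "0 \<le> \<epsilon> * (2 * real (s j) - 1)"
          using sj \<open>0 < \<epsilon>\<close> by (intro mult_nonneg_nonneg) auto
        moreover have "0 \<le> \<epsilon> * (2 * ?x + 1)" using \<open>0 < \<epsilon>\<close> by simp
        moreover have "?u i - \<theta> i * v * ?x \<le> c2 i j - ?u j"
        proof (cases "i = j")
          case True
          \<comment> \<open>A match within the type undercuts the price by
            \<open>\<theta> i * v\<close>, exactly the credit of one waiting demand, and there is at
            least one.\<close>
          have "\<theta> i * v * 1 \<le> \<theta> i * v * ?x"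
            using sj True v \<theta>_pos[of i] by (intro mult_left_mono) auto
          then show ?thesis
            using True c1_eq(2) diag[of i] by simp
        next
          case False
          have "0 \<le> \<theta> i * v * ?x" using v \<theta>_pos[of i] by simp
          then show ?thesis using cross[OF False] by simp
        qed
        ultimately show ?thesis
          using Some dec[OF sj] by simp
      qed
      \<comment> \<open>The quadratic part per unit of \<open>\<epsilon>\<close>: the gain from
        expiries grows like \<open>\<theta> i * ?x\<^sup>2\<close> and beats the linear loss at
        arrivals. Completing the square leaves \<open>(r $ i)\<^sup>2 / \<theta> i\<close>, and the
        summand 1 in \<open>2 * ?x + 1\<close> leaves \<open>r $ i\<close>.\<close>
      have square: "- ((r $ i)\<^sup>2 / \<theta> i + r $ i) \<le> ?x * (\<theta> i * (2 * ?x - 1)) - r $ i * (2 * ?x + 1)"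
      proof -
        have "0 \<le> (\<theta> i * ?x - r $ i)\<^sup>2 / \<theta> i"
          using \<theta>_pos[of i] by simp
        also have "\<dots> = \<theta> i * (?x * ?x) - 2 * r $ i * ?x + (r $ i)\<^sup>2 / \<theta> i"
          using \<theta>_pos[of i] by (simp add: field_simps power2_eq_square)
        also have "\<theta> i * (?x * ?x) \<le> \<theta> i * (?x * (2 * ?x - 1))"
        proof -
          \<comment> \<open>Integrality of the queue length matters: the inequality fails strictly
            between 0 and 1.\<close>
          have "?x * ?x \<le> ?x * (2 * ?x - 1)" by (cases "s i") (auto intro!: mult_left_mono)
          then show ?thesis using less_imp_le[OF \<theta>_pos[of i]] by (rule mult_left_mono)
        qed
        finally show ?thesis by (simp add: algebra_simps)
      qed
      have "?u i * r $ i - \<epsilon> * ((r $ i)\<^sup>2 / \<theta> i + r $ i) \<le>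
          ?u i * r $ i + \<epsilon> * (?x * (\<theta> i * (2 * ?x - 1)) - r $ i * (2 * ?x + 1))"
        using mult_left_mono[OF square less_imp_le[OF \<open>0 < \<epsilon>\<close>]]
        unfolding mult_minus_right by linarith
      also have "\<dots> = r $ i * (?u i - \<theta> i * v * ?x - \<epsilon> * (2 * ?x + 1)) +
          ?x * (\<theta> i * (r $ i * v + \<epsilon> * (2 * ?x - 1)))"
        by (simp add: algebra_simps)
      also have "\<dots> \<le> D i"
        unfolding D_def expiry using r_pos[of i]
        by (intro add_right_mono mult_left_mono arrival) simp
      finally show ?thesis .
    qed
    then have "?\<rho> \<le> (\<Sum>i\<in>UNIV. D i)"
      unfolding self_matching_cost_def sum_distrib_left sum_subtractf[symmetric] by (rule sum_mono)
    moreover have "(\<Sum>e\<in>pending \<sigma>. event_rate e * (event_cost c1 c2 \<phi> \<sigma> e +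
        (potential g (queue_state (snd (step \<phi> \<sigma> e))) - K))) =
      (\<Sum>e\<in>pending \<sigma>. event_rate e * (event_cost c1 c2 \<phi> \<sigma> e +
        potential g (queue_state (snd (step \<phi> \<sigma> e))))) - sum event_rate (pending \<sigma>) * K"
      unfolding sum_distrib_right sum_subtractf[symmetric]
      by (intro sum.cong refl) (simp add: algebra_simps)
    ultimately show "?\<rho> + sum event_rate (pending \<sigma>) * (potential g (queue_state (snd \<sigma>)) - K) \<le>
      (\<Sum>e\<in>pending \<sigma>. event_rate e * (event_cost c1 c2 \<phi> \<sigma> e +
        (potential g (queue_state (snd (step \<phi> \<sigma> e))) - K)))"
      unfolding generator_potential[OF wf adm] D_def s_def by (simp add: right_diff_distrib)
  qed
  moreover have "potential g (queue_state (snd (empty_config :: 'n config))) = 0"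
    by (simp add: potential_def queue_state_def g_def)
  ultimately show ?thesis by (simp add: K_def add.commute)
qed

lemma self_matching_cost_le_average_cost:
  assumes pos: "\<And>i. 0 < c1 i" and diag: "\<And>i. c1 i = c2 i i" and c2: "\<And>i j. 0 < c2 i j"
    and cross: "\<And>i j. i \<noteq> j \<Longrightarrow> price c1 \<theta> r i + price c1 \<theta> r j \<le> c2 i j"
    and adm: "admissible \<phi>"
  shows "ennreal (self_matching_cost c1 \<theta> r) \<le> average_cost c1 c2 \<theta> r \<phi>"
proof (rule ennreal_le_epsilon)
  fix \<delta> :: real assume "0 < \<delta>"
  let ?\<rho> = "self_matching_cost c1 \<theta> r"
  let ?C = "\<lambda>T. \<integral>\<^sup>+\<omega>. total_cost c1 c2 \<phi> T \<omega> \<partial>clock_space \<theta> r"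
  define B where "B = (\<Sum>i\<in>UNIV. (r $ i)\<^sup>2 / \<theta> i + r $ i)"
  have "0 < B"
    unfolding B_def
    by (intro sum_pos add_pos_pos divide_pos_pos zero_less_power r_pos \<theta>_pos) simp_all
  \<comment> \<open>The bound by \<open>?\<rho>\<close> keeps the reduced rate nonnegative, as the
    drift criterion requires. The bound by \<open>\<delta> / 2\<close> gives half of the error to
    the quadratic term; the other half absorbs the constant \<open>K\<close> once \<open>T\<close>
    is large.\<close>
  define \<epsilon> where "\<epsilon> = min ?\<rho> (\<delta> / 2) / B"
  have \<epsilon>: "0 < \<epsilon>" "\<epsilon> * B \<le> ?\<rho>" "\<epsilon> * B \<le> \<delta> / 2"
    using \<open>0 < B\<close> \<open>0 < \<delta>\<close> self_matching_cost_pos[of c1] pos by (simp_all add: \<epsilon>_def)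
  define K where "K = (\<Sum>i\<in>UNIV. (price c1 \<theta> r i)\<^sup>2 / (4 * \<epsilon>))"
  have "ennreal (?\<rho> - \<delta>) \<le> ?C T / ennreal T" if T: "max 0 (2 * K / \<delta>) < T" for T
  proof -
    have "0 < T" "K \<le> \<delta> / 2 * T"
      using T \<open>0 < \<delta>\<close> by (auto simp: field_simps)
    have "(?\<rho> - \<delta>) * T \<le> (?\<rho> - \<epsilon> * B) * T - K"
      using mult_right_mono[OF \<epsilon>(3), of T] \<open>0 < T\<close> \<open>K \<le> \<delta> / 2 * T\<close>
      unfolding left_diff_distrib by linarith
    then have "ennreal ((?\<rho> - \<delta>) * T) \<le> ennreal ((?\<rho> - \<epsilon> * B) * T - K)"
      by (rule ennreal_leI)
    also have "\<dots> \<le> ?C T"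
      unfolding B_def K_def
      by (rule expected_total_cost_lower_bound[OF pos diag c2 cross adm \<epsilon>(1)])
         (use \<epsilon>(2) \<open>0 < T\<close> in \<open>simp_all add: B_def\<close>)
    finally have "ennreal ((?\<rho> - \<delta>) * T) / ennreal T \<le> ?C T / ennreal T"
      by (rule divide_right_mono_ennreal)
    then show ?thesis
    proof (cases "0 \<le> ?\<rho> - \<delta>")
      case True
      then show ?thesis
        using \<open>ennreal ((?\<rho> - \<delta>) * T) / ennreal T \<le> ?C T / ennreal T\<close> \<open>0 < T\<close>
        by (simp add: divide_ennreal)
    qed (simp add: ennreal_neg)
  qed
  then have "\<forall>\<^sub>F T in at_top. ennreal (?\<rho> - \<delta>) \<le> ?C T / ennreal T"
    by (rule eventually_mono[OF eventually_gt_at_top])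
  then have "ennreal (?\<rho> - \<delta>) \<le> average_cost c1 c2 \<theta> r \<phi>"
    unfolding average_cost_def by (intro le_Limsup) simp_all
  then have "ennreal (?\<rho> - \<delta>) + ennreal \<delta> \<le> average_cost c1 c2 \<theta> r \<phi> + ennreal \<delta>"
    by (rule add_right_mono)
  \<comment> \<open>\<open>ennreal (?\<rho> - \<delta>)\<close> is 0 for a negative difference, so
    adding \<open>\<delta>\<close> back goes through the positive part.\<close>
  moreover have "ennreal ?\<rho> \<le> ennreal (max 0 (?\<rho> - \<delta>) + \<delta>)"
    by (rule ennreal_leI) simp
  moreover have "ennreal (max 0 (?\<rho> - \<delta>) + \<delta>) = ennreal (max 0 (?\<rho> - \<delta>)) + ennreal \<delta>"
    using \<open>0 < \<delta>\<close> by (intro ennreal_plus) auto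
  moreover have "ennreal (max 0 (?\<rho> - \<delta>)) = ennreal (?\<rho> - \<delta>)"
    by (simp add: max_def ennreal_neg)
  ultimately show "ennreal ?\<rho> \<le> average_cost c1 c2 \<theta> r \<phi> + ennreal \<delta>"
    by (metis order_trans)
qed

lemma mdp_value_eq:
  assumes "\<And>i. 0 < c1 i" "\<And>i. c1 i = c2 i i" "\<And>i j. 0 < c2 i j"
    and "\<And>i j. i \<noteq> j \<Longrightarrow> price c1 \<theta> r i + price c1 \<theta> r j \<le> c2 i j"
  shows "mdp_value c1 c2 \<theta> r = ennreal (self_matching_cost c1 \<theta> r)"
  unfolding mdp_value_def
proof (rule antisym)
  show "(INF \<phi>\<in>{\<phi>. admissible \<phi>}. average_cost c1 c2 \<theta> r \<phi>) \<le> ennreal (self_matching_cost c1 \<theta> r)"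
    using admissible_greedy average_cost_greedy_le[of c1 c2] assms(1-3) by (auto intro: INF_lower2)
  show "ennreal (self_matching_cost c1 \<theta> r) \<le> (INF \<phi>\<in>{\<phi>. admissible \<phi>}. average_cost c1 c2 \<theta> r \<phi>)"
    using self_matching_cost_le_average_cost[of c1 c2] assms by (intro INF_greatest) auto
qed

end

theorem proposition11:
  fixes c1 :: "'n::{finite,linorder} \<Rightarrow> real"
    and c2 :: "'n \<Rightarrow> 'n \<Rightarrow> real"
    and \<theta> :: "'n \<Rightarrow> real"
    and lo hi :: "(real, 'n) vec"
  assumes "\<And>i. 0 < c1 i"
    and "\<And>i j. 0 < c2 i j"
    and "\<And>i. c1 i = c2 i i"
    and "\<And>i j. c1 i \<le> c2 i j"
    and "\<And>i j. c2 i j = c2 j i"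
    and "0 < \<theta> (Min UNIV)"
    and "mono \<theta>"
    and "1 < \<theta> (Max UNIV) / \<theta> (Min UNIV)"
    and "\<And>i. 0 < lo $ i"
    and "critical_efficiency c1 c2 2 \<noteq> 1 / 2"
    and "\<And>i. \<theta> i * (critical_efficiency c1 c2 2 / (1 - 2 * critical_efficiency c1 c2 2)) < lo $ i"
  shows "concave_on (cbox lo hi) (lp_value c1 c2 \<theta>) \<and>
    (\<forall>r\<in>cbox lo hi. ennreal (lp_value c1 c2 \<theta> r) = mdp_value c1 c2 \<theta> r)"
proof -
  have \<theta>_pos: "0 < \<theta> i" for i
    using monoD[OF assms(7), of "Min UNIV" i] assms(6) by simp
  have cross: "price c1 \<theta> r i + price c1 \<theta> r j \<le> c2 i j"
    if "r \<in> cbox lo hi" "i \<noteq> j" for r i j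
    using assms(1,3-5) \<theta>_pos
  proof (rule price_add_le)
    show "0 < r $ i" for i
      using that(1) assms(9)[of i] by (auto simp: mem_box_cart intro: less_le_trans)
    show "\<theta> i * (critical_efficiency c1 c2 2 / (1 - 2 * critical_efficiency c1 c2 2)) < r $ i" for i
      using that(1) assms(11)[of i] by (auto simp: mem_box_cart intro: less_le_trans)
  qed (use assms(10) that in auto)
  have rates: "matching_rates \<theta> r" if "r \<in> cbox lo hi" for r
  proof
    show "0 < r $ i" for i
      using that assms(9)[of i] by (auto simp: mem_box_cart intro: less_le_trans)
  qed (rule \<theta>_pos)
  have lp: "lp_value c1 c2 \<theta> r = self_matching_cost c1 \<theta> r" if "r \<in> cbox lo hi" for r
    by (rule matching_rates.lp_value_eq[OF rates[OF that] assms(1,3) cross[OF that]])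
  have mdp: "mdp_value c1 c2 \<theta> r = ennreal (self_matching_cost c1 \<theta> r)" if "r \<in> cbox lo hi" for r
    by (rule matching_rates.mdp_value_eq[OF rates[OF that] assms(1,3,2) cross[OF that]])
  have "concave_on (cbox lo hi) (self_matching_cost c1 \<theta>)"
    using assms(1) \<theta>_pos assms(9) by (rule concave_on_self_matching_cost)
  \<comment> \<open>The two functions are known to agree on the box; its convexity keeps the mixed
    points inside.\<close>
  then have "concave_on (cbox lo hi) (lp_value c1 c2 \<theta>)"
    using convexD[OF convex_box(1)[of lo hi]] by (simp add: concave_on_iff lp)
  then show ?thesis
    by (simp add: lp mdp)
qed

end
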